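(* Let $\mathcal{G}$ be a finite connected graph with universal covering tree $\Delta$ and fundamental group $\Gamma$. Then there is an isomorphism of abelian groups $$H_1(\mathcal{G},\mathbb{Z})\cong \mathfrak{D}^\Gamma(\partial\Delta,\mathbb{Z}).$$
   Context: Each geometric edge of a graph corresponds to two directed edges, $\delta$ and its reverse $\overline\delta$; each directed edge $\delta$ has an initial vertex $o(\delta)$ and a terminal vertex $t(\delta)$, with $o(\overline\delta)=t(\delta)$. $\Delta$ is the universal covering tree of the finite connected graph $\mathcal{G}$. The fundamental group $\Gamma$ of $\mathcal{G}$ is a free group which acts on $\Delta$, with quotient $\Gamma\backslash\Delta=\mathcal{G}$, and on the boundary $\partial\Delta$. The boundary $\partial\Delta$ is the set of equivalence classes of infinite semi-geodesics in $\Delta$ (infinite one-sided edge paths without backtracking), two semi-geodesics being equivalent if they agree except on finitely many edges. For a directed edge $\delta$ of $\Delta$, $\Omega_\delta\subseteq\partial\Delta$ is the set corresponding to all semi-geodesics with initial edge $\delta$ and initial vertex $o(\delta)$. The sets $\Omega_\delta$ are clopen and form a basis for a compact totally disconnected topology on $\partial\Delta$. A $\mathbb{Z}$-valued distribution on $\partial\Delta$ is a finitely additive $\mathbb{Z}$-valued measure $\mu$ defined on the clopen subsets of $\partial\Delta$. $\mathfrak{D}^\Gamma(\partial\Delta,\mathbb{Z})$ is the additive group of all $\Gamma$-invariant $\mathbb{Z}$-valued distributions on $\partial\Delta$. Let $V$ be the vertex set and $E$ the directed edge set of $\mathcal{G}$, and choose an orientation, i.e. a partition $E=E_+\sqcup\overline{E_+}$,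 where $\overline{E_+}$ is the set of reverses of the edges in $E_+$. Then $H_1(\mathcal{G},\mathbb{Z})=\ker\partial$, where $\partial:\mathbb{Z}E_+\to\mathbb{Z}V$ is the homomorphism determined by $\partial x=t(x)-o(x)$.
   Formalization: The formal theorem assumes that the Euler characteristic of the graph is nonzero; when it is 0 (exactly one independent cycle, e.g. a single loop), the boundary is two points fixed by Γ, so the invariant distributions form Z² while H_1 = Z, and the claim fails. *)

theory Defs
  imports
    "HOL-Analysis.Analysis"
    "HOL-Algebra.Free_Abelian_Groups"
    "Graph_Theory.Digraph_Component"
    "Graph_Theory.Bidirected_Digraph"
begin

text \<open>
  A graph (loops and multiple edges allowed) is given by its vertices and directed edges, together
  with the fixed-point free edge reversal \<open>r\<close>; that is, by a \<^locale>\<open>bidirected_digraph\<close>.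
\<close>

definition orientation :: "('a, 'b) pre_digraph \<Rightarrow> ('b \<Rightarrow> 'b) \<Rightarrow> 'b set \<Rightarrow> bool" where
  "orientation G r E \<longleftrightarrow> E \<union> r ` E = arcs G \<and> E \<inter> r ` E = {}"

text \<open>There are half as many geometric edges as directed edges.\<close>

definition euler_characteristic :: "('a, 'b) pre_digraph \<Rightarrow> int" where
  "euler_characteristic G = int (card (verts G)) - int (card (arcs G) div 2)"


section \<open>First homology\<close>

definition edge_boundary :: "('a, 'b) pre_digraph \<Rightarrow> ('b \<Rightarrow>\<^sub>0 int) \<Rightarrow> ('a \<Rightarrow>\<^sub>0 int)" where
  "edge_boundary G = frag_extend (\<lambda>e. frag_of (head G e) - frag_of (tail G e))"

definition first_homology :: "('a, 'b) pre_digraph \<Rightarrow> 'b set \<Rightarrow> ('b \<Rightarrow>\<^sub>0 int) monoid" where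
  "first_homology G E =
     (free_Abelian_group E)\<lparr>carrier :=
        kernel (free_Abelian_group E) (free_Abelian_group (verts G)) (edge_boundary G)\<rparr>"


section \<open>Fundamental group and universal covering tree\<close>

text \<open>
  Homotopy classes of walks with fixed endpoints are represented by their unique reduced
  (backtracking-free) members.
\<close>

definition reduced :: "('b \<Rightarrow> 'b) \<Rightarrow> 'b list \<Rightarrow> bool" where
  "reduced r p \<longleftrightarrow> successively (\<lambda>e f. f \<noteq> r e) p"

fun reduce :: "('b \<Rightarrow> 'b) \<Rightarrow> 'b list \<Rightarrow> 'b list" where
  "reduce r [] = []"
| "reduce r (e # p) =
     (case reduce r p of
        [] \<Rightarrow> [e]
      | f # q \<Rightarrow> if f = r e then q else e # f # q)"

definition fundamental_group ::
    "('a, 'b) pre_digraph \<Rightarrow> ('b \<Rightarrow> 'b) \<Rightarrow> 'a \<Rightarrow> 'b list monoid" where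
  "fundamental_group G r v =
     \<lparr>carrier = {p. pre_digraph.awalk G v p v \<and> reduced r p},
      monoid.mult = (\<lambda>p q. reduce r (p @ q)),
      one = []\<rparr>"

text \<open>
  A vertex of the universal covering tree is a homotopy class of walks starting at the base
  vertex \<open>v\<close>; it lies over the final vertex of these walks. The directed edge \<open>(p, e)\<close> is the
  lift of \<open>e\<close> that starts at the vertex \<open>p\<close>.
\<close>

definition universal_cover ::
    "('a, 'b) pre_digraph \<Rightarrow> ('b \<Rightarrow> 'b) \<Rightarrow> 'a \<Rightarrow> ('b list, 'b list \<times> 'b) pre_digraph" where
  "universal_cover G r v =
     \<lparr>verts = {p. (\<exists>w. pre_digraph.awalk G v p w) \<and> reduced r p},
      arcs = {(p, e). (\<exists>w. pre_digraph.awalk G v p w \<and> e \<in> arcs G \<and> tail G e = w) \<and> reduced r p},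
      tail = (\<lambda>(p, e). p),
      head = (\<lambda>(p, e). reduce r (p @ [e]))\<rparr>"

text \<open>
  The library requires the reversal of a \<^locale>\<open>bidirected_digraph\<close> to be the identity
  off the set of edges.
\<close>

definition cover_rev ::
    "('a, 'b) pre_digraph \<Rightarrow> ('b \<Rightarrow> 'b) \<Rightarrow> 'a \<Rightarrow> 'b list \<times> 'b \<Rightarrow> 'b list \<times> 'b" where
  "cover_rev G r v d =
     (if d \<in> arcs (universal_cover G r v)
      then (head (universal_cover G r v) d, r (snd d)) else d)"

text \<open>
  The action of the fundamental group on the edges of the covering tree. On vertices it is
  \<open>p \<mapsto> reduce r (g @ p)\<close>.
\<close>

definition cover_act :: "('b \<Rightarrow> 'b) \<Rightarrow> 'b list \<Rightarrow> 'b list \<times> 'b \<Rightarrow> 'b list \<times> 'b" where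
  "cover_act r g = (\<lambda>(p, e). (reduce r (g @ p), e))"


section \<open>The boundary of a tree\<close>

definition semi_geodesics :: "('v, 'd) pre_digraph \<Rightarrow> ('d \<Rightarrow> 'd) \<Rightarrow> (nat \<Rightarrow> 'd) set" where
  "semi_geodesics T r =
     {x. \<forall>i. x i \<in> arcs T \<and> tail T (x (Suc i)) = head T (x i) \<and> x (Suc i) \<noteq> r (x i)}"

text \<open>
  Two semi-geodesics agree except on finitely many edges if they coincide after finite initial
  segments, possibly of different lengths, have been removed from both.
\<close>

definition cofinal_rel ::
    "('v, 'd) pre_digraph \<Rightarrow> ('d \<Rightarrow> 'd) \<Rightarrow> ((nat \<Rightarrow> 'd) \<times> (nat \<Rightarrow> 'd)) set" where
  "cofinal_rel T r =
     {(x, y). x \<in> semi_geodesics T r \<and> y \<in> semi_geodesics T r \<and>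
              (\<exists>m n. \<forall>i. x (m + i) = y (n + i))}"

definition tree_boundary :: "('v, 'd) pre_digraph \<Rightarrow> ('d \<Rightarrow> 'd) \<Rightarrow> (nat \<Rightarrow> 'd) set set" where
  "tree_boundary T r = semi_geodesics T r // cofinal_rel T r"

definition boundary_cylinder ::
    "('v, 'd) pre_digraph \<Rightarrow> ('d \<Rightarrow> 'd) \<Rightarrow> 'd \<Rightarrow> (nat \<Rightarrow> 'd) set set" where
  "boundary_cylinder T r d = {\<omega> \<in> tree_boundary T r. \<exists>x\<in>\<omega>. x 0 = d}"

text \<open>The cylinder sets cover the boundary, so that it is the whole space of this topology.\<close>

definition boundary_topology ::
    "('v, 'd) pre_digraph \<Rightarrow> ('d \<Rightarrow> 'd) \<Rightarrow> (nat \<Rightarrow> 'd) set topology" where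
  "boundary_topology T r = topology_generated_by (boundary_cylinder T r ` arcs T)"

definition boundary_act :: "('d \<Rightarrow> 'd) \<Rightarrow> (nat \<Rightarrow> 'd) set \<Rightarrow> (nat \<Rightarrow> 'd) set" where
  "boundary_act g \<omega> = (\<lambda>x. g \<circ> x) ` \<omega>"


section \<open>Distributions\<close>

definition clopens :: "'x topology \<Rightarrow> 'x set set" where
  "clopens X = {A. openin X A \<and> closedin X A}"

text \<open>
  A distribution is a function on the clopen sets only. It is represented by its extension
  by zero to all sets, which makes equality of distributions the equality of functions.
\<close>

definition distributions :: "'x topology \<Rightarrow> ('x set \<Rightarrow> int) set" where
  "distributions X = {\<mu>. additive (clopens X) \<mu> \<and> (\<forall>A. A \<notin> clopens X \<longrightarrow> \<mu> A = 0)}"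

definition invariant_distributions ::
    "('a, 'b) pre_digraph \<Rightarrow> ('b \<Rightarrow> 'b) \<Rightarrow> 'a
      \<Rightarrow> ((nat \<Rightarrow> 'b list \<times> 'b) set set \<Rightarrow> int) monoid" where
  "invariant_distributions G r v =
     (let X = boundary_topology (universal_cover G r v) (cover_rev G r v) in
      \<lparr>carrier = {\<mu> \<in> distributions X.
          \<forall>g \<in> carrier (fundamental_group G r v). \<forall>A \<in> clopens X.
            \<mu> (boundary_act (cover_act r g) ` A) = \<mu> A},
       monoid.mult = (\<lambda>\<mu> \<nu> A. \<mu> A + \<nu> A),
       one = (\<lambda>A. 0)\<rparr>)"

end

theory Submission
  imports Defs
begin

text \<open>
  The proof is bookkeeping with the values of a distribution on cylinders, which rests on two
  facts about the covering tree. The cylinders of the edges that leave a fixed vertex partition the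
  boundary (\<open>boundary_eq_Union_cylinders\<close>, \<open>disjoint_cylinders\<close>), and the cylinders of an edge and
  of its reverse are complementary (\<open>cylinder_reversal\<close>).

  From distributions to cycles: the lifts of an arc \<open>e\<close> of \<open>G\<close> form one orbit of the fundamental
  group, so an invariant distribution \<open>\<mu>\<close> has one common value \<open>m e\<close> on their cylinders
  (\<open>arc_mass_eq\<close>). Let \<open>M\<close> be the mass of the whole boundary. The two facts say that the values
  \<open>m e\<close> over the arcs leaving any given vertex sum to \<open>M\<close>, and that \<open>m e + m (r e) = M\<close>. Summing
  \<open>m\<close> over all arcs, once vertex by vertex and once over pairs of opposite arcs, gives
  \<open>|V| * M = |E| * M\<close> for the numbers of vertices and of geometric edges (\<open>total_mass\<close>). As the
  Euler characteristic is nonzero, \<open>M = 0\<close>. Hence \<open>m\<close> is antisymmetric under reversal and its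
  outflow vanishes at every vertex, which means that its restriction to the oriented arcs is a cycle.

  From cycles to distributions: the boundary is the set of branches of the tree of reduced walks
  from the base vertex, because every class of semi-geodesics has exactly one member that starts
  there. Extend a cycle antisymmetrically to all arcs and weigh a reduced walk by the value at its
  last arc, the empty walk by \<open>0\<close>. Conservation at the vertices says that the weight of a walk is
  the sum of the weights of its one-step extensions. Such a weight extends to a finitely additive
  function on the sets of branches that depend on a bounded initial segment, and by Koenig's lemma
  every clopen set is of this kind (\<open>clopen_determined\<close>). One difficulty is that \<open>G\<close> may have
  vertices of degree one, so that some cylinders are empty; walks that lie on no branch have weight
  \<open>0\<close>, again by Koenig's lemma (\<open>harmonic_eq_0_if_no_branch\<close>). The value of this function on the
  cylinder of an edge is the flow through the arc below the edge, also for the edges that point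
  towards the base vertex, because the total mass is \<open>0\<close> (\<open>cycle_distribution_cylinder\<close>). This gives
  invariance, and it shows that the two constructions are inverse to each other, since a
  distribution is determined by its values on cylinders (\<open>distribution_eqI\<close>).
\<close>

section \<open>Free reduction of words\<close>

locale free_reduction =
  fixes r :: "'b \<Rightarrow> 'b"
  assumes involution [simp]: "r (r e) = e"
begin

definition formal_inverse :: "'b list \<Rightarrow> 'b list" where
  "formal_inverse p = map r (rev p)"

lemma reduced_Nil [simp]: "reduced r []"
  by (simp add: reduced_def)

lemma reduced_Cons:
  "reduced r (e # p) \<longleftrightarrow> reduced r p \<and> (p = [] \<or> hd p \<noteq> r e)"
  by (cases p) (auto simp: reduced_def)

lemma reduced_snoc:
  "reduced r (p @ [e]) \<longleftrightarrow> reduced r p \<and> (p = [] \<or> e \<noteq> r (last p))"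
  by (auto simp: reduced_def successively_append_iff)

lemma reduced_reduce: "reduced r (reduce r p)"
  by (induction p) (auto split: list.splits simp: reduced_Cons)

lemma reduce_eq_self: "reduced r p \<Longrightarrow> reduce r p = p"
  by (induction p) (auto split: list.splits simp: reduced_Cons)

lemma reduce_append_right: "reduce r (p @ reduce r q) = reduce r (p @ q)"
  by (induction p) (auto simp: reduce_eq_self reduced_reduce)

lemma reduce_cancel: "reduce r (e # r e # p) = reduce r p"
  using reduced_reduce[of p] by (auto split: list.splits simp: reduced_Cons)

text \<open>
  Together with \<open>reduce_append_right\<close>, this makes free reduction a congruence for concatenation:
  the group law and the action on the covering tree can be computed with unreduced words.
\<close>

lemma reduce_append_left: "reduce r (reduce r p @ q) = reduce r (p @ q)"
proof (induction p)
  case (Cons e p)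
  show ?case
  proof (cases "\<exists>s. reduce r p = r e # s")
    case True
    then obtain s where s: "reduce r p = r e # s" ..
    have "reduce r (e # p @ q) = reduce r (e # reduce r p @ q)"
      using Cons.IH by simp
    also have "\<dots> = reduce r (s @ q)"
      unfolding s append_Cons by (rule reduce_cancel)
    finally show ?thesis using s by simp
  next
    case False
    then have "reduce r (e # p) = e # reduce r p"
      by (auto split: list.splits)
    then show ?thesis using Cons.IH by simp
  qed
qed simp

lemma reduce_snoc_cancel:
  assumes "reduced r p"
  shows "reduce r (p @ [e, r e]) = p"
  using reduce_append_right[of p "[e, r e]"] assms by (simp add: reduce_eq_self)

lemma reduce_formal_inverse_left: "reduce r (formal_inverse p @ p) = []"
proof (induction p)
  case (Cons e p)
  have "reduce r (formal_inverse (e # p) @ e # p)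
      = reduce r (formal_inverse p @ reduce r (r e # r (r e) # p))"
    by (simp only: reduce_append_right) (simp add: formal_inverse_def)
  then show ?case
    using Cons by (simp only: reduce_cancel reduce_append_right)
qed (simp add: formal_inverse_def)

lemma formal_inverse_invol [simp]: "formal_inverse (formal_inverse p) = p"
  by (simp add: formal_inverse_def rev_map comp_def)

lemma reduce_inverse_act:
  assumes "reduced r p"
  shows "reduce r (formal_inverse g @ reduce r (g @ p)) = p"
proof -
  have "reduce r (formal_inverse g @ reduce r (g @ p)) = reduce r ((formal_inverse g @ g) @ p)"
    by (simp add: reduce_append_right)
  also have "\<dots> = reduce r (reduce r (formal_inverse g @ g) @ p)"
    by (simp only: reduce_append_left)
  finally show ?thesis
    using assms by (simp add: reduce_formal_inverse_left reduce_eq_self)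
qed

end

section \<open>Finitely additive contents on the branches of a tree of words\<close>

definition stem :: "(nat \<Rightarrow> 'b) \<Rightarrow> nat \<Rightarrow> 'b list" where
  "stem w n = map w [0..<n]"

lemma stem_0 [simp]: "stem w 0 = []"
  by (simp add: stem_def)

lemma stem_Suc: "stem w (Suc n) = stem w n @ [w n]"
  by (simp add: stem_def)

lemma length_stem [simp]: "length (stem w n) = n"
  by (simp add: stem_def)

lemma take_stem: "m \<le> n \<Longrightarrow> take m (stem w n) = stem w m"
  by (simp add: stem_def take_map)

lemma stem_mono: "stem w n = stem w' n \<Longrightarrow> m \<le> n \<Longrightarrow> stem w m = stem w' m"
  by (metis take_stem)

lemma stem_ext:
  assumes "\<And>n. stem w n = stem w' n"
  shows "w = w'"
proof
  fix i
  show "w i = w' i"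
    using assms[of "Suc i"] by (simp add: stem_Suc)
qed

text \<open>
  Words over a finite alphabet, closed under prefixes, form a finitely branching rooted tree. Words
  without extension are allowed, so a word need not lie on any branch.
\<close>

locale word_tree =
  fixes T :: "'b list set" and S :: "'b set"
  assumes finite_alphabet: "finite S"
    and alphabet: "p \<in> T \<Longrightarrow> set p \<subseteq> S"
    and prefix_closed: "p @ [e] \<in> T \<Longrightarrow> p \<in> T"
begin

definition branches :: "(nat \<Rightarrow> 'b) set" where
  "branches = {w. \<forall>n. stem w n \<in> T}"

text \<open>
  The property \<open>P\<close> cuts out a subtree; it is needed as a parameter because Koenig's lemma is
  applied to subtrees.
\<close>

lemma take_in_tree:
  assumes "\<And>p e. p @ [e] \<in> T \<Longrightarrow> P (p @ [e]) \<Longrightarrow> P p" and "q \<in> T" "P q"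
  shows "take k q \<in> T \<and> P (take k q)"
  using assms(2,3)
proof (induction q rule: rev_induct)
  case (snoc e q)
  then show ?case
    using prefix_closed[of q e] assms(1)[of q e] by (cases "k \<le> length q") auto
qed simp

text \<open>
  Koenig's lemma: a word with infinitely many descendants in the subtree cut out by \<open>P\<close> has a
  one-letter extension with the same property, since the alphabet is finite. Iterating this from the
  empty word produces the branch.
\<close>

lemma konig:
  assumes anc: "\<And>p e. p @ [e] \<in> T \<Longrightarrow> P (p @ [e]) \<Longrightarrow> P p"
    and lev: "\<And>n. \<exists>p\<in>T. length p = n \<and> P p"
  shows "\<exists>w\<in>branches. \<forall>n. P (stem w n)"
proof -
  define D where "D p = {q \<in> T. P q \<and> take (length p) q = p}" for p
  have inf_Nil: "infinite (D [])"
  proof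
    assume "finite (D [])"
    then have "finite (length ` D [])" by simp
    moreover have "length ` D [] = UNIV"
    proof (intro equalityI subset_UNIV subsetI)
      fix n show "n \<in> length ` D []"
        using lev[of n] by (force simp: D_def)
    qed
    ultimately show False by simp
  qed
  have step: "\<exists>e. infinite (D (p @ [e]))" if "infinite (D p)" for p
  proof (rule ccontr)
    assume fin: "\<not> (\<exists>e. infinite (D (p @ [e])))"
    have "D p \<subseteq> insert p (\<Union>e\<in>S. D (p @ [e]))"
    proof
      fix q assume q: "q \<in> D p"
      show "q \<in> insert p (\<Union>e\<in>S. D (p @ [e]))"
      proof (cases "length q \<le> length p")
        case True
        with q show ?thesis by (simp add: D_def)
      next
        case False
        then have "take (Suc (length p)) q = p @ [q ! length p]" "q ! length p \<in> S"
          using q alphabet[of q] by (auto simp: D_def take_Suc_conv_app_nth subset_iff)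
        with q show ?thesis by (auto simp: D_def)
      qed
    qed
    then have "finite (D p)"
      using fin finite_alphabet by (meson finite.insertI finite_UN finite_subset)
    with that show False ..
  qed
  then obtain c where c: "\<And>p. infinite (D p) \<Longrightarrow> infinite (D (p @ [c p]))"
    by metis
  define s where "s = rec_nat [] (\<lambda>_ p. p @ [c p])"
  have s [simp]: "s 0 = []" "s (Suc n) = s n @ [c (s n)]" for n
    by (simp_all add: s_def)
  define w where "w n = c (s n)" for n
  have stem_w: "stem w n = s n" for n
    by (induction n) (simp_all add: stem_Suc w_def)
  have "infinite (D (s n))" for n
    by (induction n) (use inf_Nil c in auto)
  then have "\<exists>q. q \<in> D (s n)" for n
    by (metis finite.emptyI ex_in_conv)
  then obtain q where "\<And>n. q n \<in> T \<and> P (q n) \<and> take (length (s n)) (q n) = s n"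
    unfolding D_def mem_Collect_eq by metis
  then have "s n \<in> T \<and> P (s n)" for n
    using take_in_tree[of P "q n" "length (s n)"] anc by simp
  then show ?thesis
    by (intro bexI[of _ w]) (auto simp: branches_def stem_w)
qed

definition determined :: "nat \<Rightarrow> (nat \<Rightarrow> 'b) set \<Rightarrow> bool" where
  "determined n A \<longleftrightarrow>
     (\<forall>w\<in>branches. \<forall>w'\<in>branches. stem w n = stem w' n \<longrightarrow> (w \<in> A \<longleftrightarrow> w' \<in> A))"

lemma determined_mono: "determined m A \<Longrightarrow> m \<le> n \<Longrightarrow> determined n A"
  unfolding determined_def using stem_mono by blast

lemma determined_Un: "determined n A \<Longrightarrow> determined n B \<Longrightarrow> determined n (A \<union> B)"
  unfolding determined_def by blast

text \<open>
  Compactness of the space of branches: the words whose cylinder meets both \<open>A\<close> and its complement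
  form a subtree. If \<open>A\<close> were determined by no initial segment, this subtree would contain an
  infinite branch, near which \<open>A\<close> could not be locally constant.
\<close>

lemma locally_constant_imp_determined:
  assumes loc: "\<And>w. w \<in> branches \<Longrightarrow>
    \<exists>n. \<forall>w'\<in>branches. stem w' n = stem w n \<longrightarrow> (w' \<in> A \<longleftrightarrow> w \<in> A)"
  shows "\<exists>n. determined n A"
proof (rule ccontr)
  assume no: "\<nexists>n. determined n A"
  define P where "P p \<longleftrightarrow> (\<exists>w\<in>branches. \<exists>w'\<in>branches.
    stem w (length p) = p \<and> stem w' (length p) = p \<and> w \<in> A \<and> w' \<notin> A)" for p
  have "\<exists>w\<in>branches. \<forall>n. P (stem w n)"
  proof (rule konig)
    show "P p" if "P (p @ [e])" for p e
      using that unfolding P_def by (auto simp: stem_Suc)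
    show "\<exists>p\<in>T. length p = n \<and> P p" for n
    proof -
      obtain w w' where w: "w \<in> branches" "w' \<in> branches" "stem w n = stem w' n" "w \<in> A" "w' \<notin> A"
        using no unfolding determined_def by metis
      then show ?thesis
        by (intro bexI[of _ "stem w n"]) (auto simp: P_def branches_def)
    qed
  qed
  then obtain w where w: "w \<in> branches" "\<And>n. P (stem w n)" by blast
  from loc[OF w(1)] obtain n where
    "\<forall>w'\<in>branches. stem w' n = stem w n \<longrightarrow> (w' \<in> A \<longleftrightarrow> w \<in> A)" ..
  with w(2)[of n] show False unfolding P_def by auto
qed

definition harmonic :: "('b list \<Rightarrow> 'c::ab_group_add) \<Rightarrow> bool" where
  "harmonic F \<longleftrightarrow> (\<forall>p\<in>T. F p = (\<Sum>e | p @ [e] \<in> T. F (p @ [e])))"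

definition children :: "'b list set \<Rightarrow> 'b list set" where
  "children Q = (\<lambda>(p, e). p @ [e]) ` (SIGMA p:Q. {e. p @ [e] \<in> T})"

lemma finite_successors: "finite {e. p @ [e] \<in> T}"
  by (rule finite_subset[OF _ finite_alphabet]) (use alphabet in fastforce)

lemma finite_children: "finite Q \<Longrightarrow> finite (children Q)"
  unfolding children_def by (intro finite_imageI finite_SigmaI finite_successors)

lemma sum_children:
  assumes "harmonic F" "finite Q" "Q \<subseteq> T"
  shows "sum F (children Q) = sum F Q"
proof -
  have "sum F (children Q) = (\<Sum>(p, e)\<in>(SIGMA p:Q. {e. p @ [e] \<in> T}). F (p @ [e]))"
    unfolding children_def by (subst sum.reindex) (auto simp: inj_on_def case_prod_unfold)
  also have "\<dots> = (\<Sum>p\<in>Q. \<Sum>e | p @ [e] \<in> T. F (p @ [e]))"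
    using assms(2) finite_successors by (intro sum.Sigma[symmetric]) auto
  also have "\<dots> = sum F Q"
    using assms(1,3) by (intro sum.cong) (auto simp: harmonic_def)
  finally show ?thesis .
qed

text \<open>
  The weight of a word is the sum of the weights of its descendants at any later level. If it is
  nonzero, there are descendants at every level, and Koenig's lemma puts the word on a branch.
\<close>

lemma harmonic_eq_0_if_no_branch:
  assumes F: "harmonic F" and p: "p \<in> T"
    and no: "\<And>w. w \<in> branches \<Longrightarrow> stem w (length p) \<noteq> p"
  shows "F p = 0"
proof (rule ccontr)
  assume nz: "F p \<noteq> 0"
  define Q where "Q k = (children ^^ k) {p}" for k
  have Q: "finite (Q k) \<and> Q k \<subseteq> T \<and> sum F (Q k) = F p \<and>
      (\<forall>q\<in>Q k. length q = length p + k \<and> take (length p) q = p)" for k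
  proof (induction k)
    case (Suc k)
    have Suc_Q: "Q (Suc k) = children (Q k)" by (simp add: Q_def)
    have "Q (Suc k) \<subseteq> T" "\<forall>q\<in>Q (Suc k). length q = length p + Suc k \<and> take (length p) q = p"
      using Suc by (auto simp: Suc_Q children_def)
    then show ?case
      using Suc sum_children[OF F, of "Q k"] finite_children[of "Q k"] by (simp add: Suc_Q)
  qed (simp add: Q_def p)
  \<comment> \<open>The subtree consists of the words comparable with p; a branch of it passes through p.\<close>
  have "\<exists>w\<in>branches. \<forall>n. take (length p) (stem w n) = take (length (stem w n)) p"
  proof (rule konig[where P = "\<lambda>q. take (length p) q = take (length q) p"])
    show "take (length p) q = take (length q) p"
      if "take (length p) (q @ [e]) = take (length (q @ [e])) p" for q e
    proof (cases "length p \<le> length q")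
      case False
      then have "q @ [e] = take (Suc (length q)) p" using that by simp
      then have "q = take (length q) (take (Suc (length q)) p)" by (metis append_eq_conv_conj)
      then show ?thesis using False by (simp add: min_def)
    qed (use that in auto)
    show "\<exists>q\<in>T. length q = n \<and> take (length p) q = take (length q) p" for n
    proof (cases "n \<le> length p")
      case True
      then show ?thesis
        using take_in_tree[of "\<lambda>_. True" p n] p by (intro bexI[of _ "take n p"]) auto
    next
      case False
      have "sum F (Q (n - length p)) \<noteq> 0"
        using Q nz by metis
      then have "Q (n - length p) \<noteq> {}" by force
      then obtain q where q: "q \<in> Q (n - length p)" by blast
      then have "q \<in> T" "length q = length p + (n - length p)" "take (length p) q = p"
        using Q by blast+
      then show ?thesis
        using False by (intro bexI[of _ q]) auto
    qed
  qed
  then obtain w where w: "w \<in> branches"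
      "\<forall>n. take (length p) (stem w n) = take (length (stem w n)) p" ..
  have "stem w (length p) = p"
    using spec[OF w(2), of "length p"] by simp
  with no[OF w(1)] show False ..
qed

lemma set_stem_subset: "w \<in> branches \<Longrightarrow> set (stem w n) \<subseteq> S"
  by (simp add: branches_def alphabet)

lemma finite_stems:
  assumes "A \<subseteq> branches"
  shows "finite ((\<lambda>w. stem w n) ` A)"
proof (rule finite_subset)
  show "(\<lambda>w. stem w n) ` A \<subseteq> {p. set p \<subseteq> S \<and> length p = n}"
  proof (intro image_subsetI CollectI conjI)
    fix w assume "w \<in> A"
    then show "set (stem w n) \<subseteq> S" using set_stem_subset assms by blast
  qed simp
qed (rule finite_lists_length_eq[OF finite_alphabet])

text \<open>
  Passing from the stems of length \<open>n\<close> to all their children does not change the sum, as \<open>F\<close> is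
  harmonic. A child that is not a stem of \<open>A\<close> lies on no branch at all, because \<open>A\<close> contains every
  branch through its parent; so it contributes \<open>0\<close>.
\<close>

lemma sum_stems_Suc:
  assumes F: "harmonic F" and A: "A \<subseteq> branches" "determined n A"
  shows "sum F ((\<lambda>w. stem w (Suc n)) ` A) = sum F ((\<lambda>w. stem w n) ` A)"
proof -
  let ?Q = "(\<lambda>w. stem w n) ` A"
  have T: "?Q \<subseteq> T" using A(1) by (auto simp: branches_def)
  have "sum F ((\<lambda>w. stem w (Suc n)) ` A) = sum F (children ?Q)"
  proof (rule sum.mono_neutral_left)
    show "finite (children ?Q)"
      by (intro finite_children finite_stems A)
    show "(\<lambda>w. stem w (Suc n)) ` A \<subseteq> children ?Q"
    proof
      fix p assume "p \<in> (\<lambda>w. stem w (Suc n)) ` A"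
      then obtain w where w: "w \<in> A" "p = stem w (Suc n)" by blast
      moreover have "stem w (Suc n) \<in> T" using w(1) A(1) unfolding branches_def by blast
      ultimately show "p \<in> children ?Q"
        unfolding children_def
        by (intro image_eqI[of _ _ "(stem w n, w n)"]) (auto simp: stem_Suc)
    qed
    show "\<forall>p\<in>children ?Q - (\<lambda>w. stem w (Suc n)) ` A. F p = 0"
    proof
      fix p assume p: "p \<in> children ?Q - (\<lambda>w. stem w (Suc n)) ` A"
      then obtain a e where a: "a \<in> A" "p = stem a n @ [e]" "p \<in> T"
        by (auto simp: children_def)
      show "F p = 0"
      proof (rule harmonic_eq_0_if_no_branch[OF F a(3)])
        fix w assume w: "w \<in> branches"
        show "stem w (length p) \<noteq> p"
        proof
          assume eq: "stem w (length p) = p"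
          then have "stem w n = stem a n" using a(2) by (simp add: stem_Suc)
          then have "w \<in> A"
            using A w a(1) unfolding determined_def by blast
          with eq p a(2) show False by (auto simp: image_iff)
        qed
      qed
    qed
  qed
  also have "\<dots> = sum F ?Q"
    by (rule sum_children[OF F finite_stems[OF A(1)] T])
  finally show ?thesis .
qed

lemma sum_stems_eq:
  assumes "harmonic F" "A \<subseteq> branches" "determined m A" "m \<le> n"
  shows "sum F ((\<lambda>w. stem w n) ` A) = sum F ((\<lambda>w. stem w m) ` A)"
  using assms(4)
proof (induction n rule: dec_induct)
  case (step n)
  then show ?case
    using sum_stems_Suc[OF assms(1,2) determined_mono[OF assms(3), of n]] by simp
qed simp

text \<open>
  The least level serves to make a choice that does not depend on \<open>F\<close>, so that \<open>content\<close> is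
  visibly additive in \<open>F\<close>; for harmonic \<open>F\<close>, any level that determines \<open>A\<close> gives the same sum.
\<close>

definition content :: "('b list \<Rightarrow> 'c::ab_group_add) \<Rightarrow> (nat \<Rightarrow> 'b) set \<Rightarrow> 'c" where
  "content F A = sum F ((\<lambda>w. stem w (LEAST n. determined n A)) ` A)"

lemma content_eq:
  assumes "harmonic F" "A \<subseteq> branches" "determined n A"
  shows "content F A = sum F ((\<lambda>w. stem w n) ` A)"
proof -
  let ?k = "LEAST n. determined n A"
  have "determined ?k A" "?k \<le> n"
    using assms(3) by (rule LeastI, rule Least_le)
  from sum_stems_eq[OF assms(1,2) this] show ?thesis
    by (simp add: content_def)
qed

lemma content_Un:
  assumes F: "harmonic F" and AB: "A \<subseteq> branches" "B \<subseteq> branches" "A \<inter> B = {}"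
    and det: "determined m A" "determined n B"
  shows "content F (A \<union> B) = content F A + content F B"
proof -
  define k where "k = max m n"
  have k: "determined k A" "determined k B"
    using det by (auto simp: k_def intro: determined_mono)
  have "(\<lambda>w. stem w k) ` A \<inter> (\<lambda>w. stem w k) ` B = {}"
  proof (rule ccontr)
    assume "(\<lambda>w. stem w k) ` A \<inter> (\<lambda>w. stem w k) ` B \<noteq> {}"
    then obtain a b where "a \<in> A" "b \<in> B" "stem a k = stem b k" by auto
    moreover from this have "b \<in> A"
      using AB(1,2) k(1) unfolding determined_def by blast
    ultimately show False using AB(3) by blast
  qed
  then have "sum F ((\<lambda>w. stem w k) ` (A \<union> B))
      = sum F ((\<lambda>w. stem w k) ` A) + sum F ((\<lambda>w. stem w k) ` B)"
    using AB(1,2) by (simp add: image_Un sum.union_disjoint finite_stems)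
  then show ?thesis
    using content_eq[OF F AB(1) k(1)] content_eq[OF F AB(2) k(2)]
      content_eq[OF F _ determined_Un[OF k]] AB(1,2) by simp
qed

lemma content_cylinder:
  assumes "harmonic F" "p \<in> T"
  shows "content F {w \<in> branches. stem w (length p) = p} = F p" (is "content F ?A = _")
proof -
  have "content F ?A = sum F ((\<lambda>w. stem w (length p)) ` ?A)"
    by (rule content_eq[OF assms(1)]) (auto simp: determined_def)
  also have "\<dots> = F p"
  proof (cases "?A = {}")
    case True
    then have "F p = 0"
      by (intro harmonic_eq_0_if_no_branch[OF assms]) blast
    then show ?thesis by (simp add: True)
  next
    case False
    then have "(\<lambda>w. stem w (length p)) ` ?A = {p}" by auto
    then show ?thesis by simp
  qed
  finally show ?thesis .
qed

end

section \<open>Finite additivity of distributions\<close>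

lemma distribution_Un:
  "\<mu> \<in> distributions X \<Longrightarrow> A \<in> clopens X \<Longrightarrow> B \<in> clopens X \<Longrightarrow> A \<inter> B = {} \<Longrightarrow>
    \<mu> (A \<union> B) = \<mu> A + \<mu> B"
  by (auto simp: distributions_def dest: additiveD)

lemma distribution_empty:
  assumes "\<mu> \<in> distributions X"
  shows "\<mu> {} = 0"
  using distribution_Un[OF assms, of "{}" "{}"] by (simp add: clopens_def)

lemma distribution_UN:
  assumes \<mu>: "\<mu> \<in> distributions X" and "finite I"
    and "\<And>i. i \<in> I \<Longrightarrow> A i \<in> clopens X" and "disjoint_family_on A I"
  shows "\<mu> (\<Union>i\<in>I. A i) = (\<Sum>i\<in>I. \<mu> (A i))"
  using assms(2-4)
proof (induction I rule: finite_induct)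
  case empty
  then show ?case using distribution_empty[OF \<mu>] by simp
next
  case (insert i I)
  have "(\<Union>j\<in>I. A j) \<in> clopens X"
    using insert.hyps(1) insert.prems(1) by (auto simp: clopens_def intro!: closedin_Union)
  moreover have "A i \<inter> (\<Union>j\<in>I. A j) = {}"
    using insert.hyps(2) insert.prems(2) by (fastforce simp: disjoint_family_on_def)
  moreover have "disjoint_family_on A I"
    using insert.prems(2) by (auto simp: disjoint_family_on_def)
  ultimately show ?case
    using insert distribution_Un[OF \<mu>, of "A i" "\<Union>j\<in>I. A j"] by simp
qed

section \<open>Ends of the universal covering tree\<close>

locale pointed_graph = fin_digraph G + bidirected_digraph G r
  for G :: "('a, 'b) pre_digraph" and r :: "'b \<Rightarrow> 'b" +
  fixes v :: 'a
  assumes connected: "Digraph_Component.connected G"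
    and base: "v \<in> verts G"
begin

sublocale free_reduction r
  by unfold_locales simp

abbreviation tip :: "'b list \<Rightarrow> 'a" where
  "tip p \<equiv> awlast v p"

definition reduced_walks :: "'b list set" where
  "reduced_walks = {p. (\<exists>w. awalk v p w) \<and> reduced r p}"

abbreviation "cover \<equiv> universal_cover G r v"
abbreviation "cover_reversal \<equiv> cover_rev G r v"
abbreviation "rays \<equiv> semi_geodesics cover cover_reversal"
abbreviation "cofinality \<equiv> cofinal_rel cover cover_reversal"
abbreviation "boundary \<equiv> tree_boundary cover cover_reversal"
abbreviation "boundary_space \<equiv> boundary_topology cover cover_reversal"
abbreviation "cylinder \<equiv> boundary_cylinder cover cover_reversal"

lemma awlast_eq: "awalk u p w \<Longrightarrow> awlast u p = w"
  by auto

lemma in_reduced_walks: "p \<in> reduced_walks \<longleftrightarrow> awalk v p (tip p) \<and> reduced r p"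
  using awlast_eq by (auto simp: reduced_walks_def)

lemma tip_snoc [simp]: "tip (p @ [e]) = head G e"
  by (simp add: awalk_verts_conv)

lemma Nil_reduced_walk [simp]: "[] \<in> reduced_walks"
  by (simp add: in_reduced_walks awalk_Nil_iff base)

lemma snoc_reduced_walk:
  "p @ [e] \<in> reduced_walks \<longleftrightarrow>
     p \<in> reduced_walks \<and> e \<in> arcs G \<and> tail G e = tip p \<and> (p = [] \<or> e \<noteq> r (last p))"
  by (auto simp: in_reduced_walks reduced_snoc awalk_append_iff awalk_Cons_iff awalk_Nil_iff
      simp del: awalk_verts.simps)

sublocale word_tree reduced_walks "arcs G"
proof
  show "finite (arcs G)" by simp
  show "set p \<subseteq> arcs G" if "p \<in> reduced_walks" for p
    using that by (auto simp: in_reduced_walks)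
  show "p \<in> reduced_walks" if "p @ [e] \<in> reduced_walks" for p e
    using that by (simp only: snoc_reduced_walk)
qed

lemma awalk_reduce: "awalk u p w \<Longrightarrow> awalk u (reduce r p) w"
proof (induction p arbitrary: u)
  case (Cons e p)
  then have "awalk (head G e) (reduce r p) w" "e \<in> arcs G" "u = tail G e"
    by (auto simp: awalk_Cons_iff)
  then show ?case
    by (auto simp: awalk_Cons_iff split: list.splits)
qed simp

lemma awalk_formal_inverse: "awalk u p w \<Longrightarrow> awalk w (formal_inverse p) u"
proof (induction p arbitrary: u)
  case Nil
  then show ?case by (auto simp: formal_inverse_def awalk_Nil_iff)
next
  case (Cons e p)
  then have e: "e \<in> arcs G" "u = tail G e" "awalk w (formal_inverse p) (head G e)"
    by (auto simp: awalk_Cons_iff)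
  then have "awalk (head G e) [r e] u"
    by (simp add: awalk_Cons_iff awalk_Nil_iff)
  with e(3) show ?case
    by (auto simp: formal_inverse_def)
qed

lemma reduce_reduced_walk:
  assumes "awalk v p w"
  shows "reduce r p \<in> reduced_walks" "tip (reduce r p) = w"
proof -
  have "awalk v (reduce r p) w" using assms by (rule awalk_reduce)
  then show "reduce r p \<in> reduced_walks" "tip (reduce r p) = w"
    using reduced_reduce by (auto simp: reduced_walks_def)
qed

lemma cover_arcs: "(q, e) \<in> arcs cover \<longleftrightarrow> q \<in> reduced_walks \<and> e \<in> arcs G \<and> tail G e = tip q"
  using awlast_eq by (auto simp: universal_cover_def in_reduced_walks)

lemma cover_tail [simp]: "tail cover = fst"
  by (auto simp: universal_cover_def)

lemma cover_head [simp]: "head cover d = reduce r (fst d @ [snd d])"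
  by (simp add: universal_cover_def case_prod_unfold)

lemma cover_reversal_eq:
  "d \<in> arcs cover \<Longrightarrow> cover_reversal d = (reduce r (fst d @ [snd d]), r (snd d))"
  by (simp add: cover_rev_def)

text \<open>
  Since consecutive edges of a semi-geodesic share a vertex, the absence of backtracking can be read
  off the underlying arcs of \<open>G\<close>.
\<close>

lemma rays_iff:
  "x \<in> rays \<longleftrightarrow> (\<forall>i. x i \<in> arcs cover \<and> fst (x (Suc i)) = reduce r (fst (x i) @ [snd (x i)]) \<and>
     snd (x (Suc i)) \<noteq> r (snd (x i)))"
proof -
  have "(x i \<in> arcs cover \<and> tail cover (x (Suc i)) = head cover (x i) \<and>
         x (Suc i) \<noteq> cover_reversal (x i)) \<longleftrightarrow>
        (x i \<in> arcs cover \<and> fst (x (Suc i)) = reduce r (fst (x i) @ [snd (x i)]) \<and>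
         snd (x (Suc i)) \<noteq> r (snd (x i)))" for i
    by (cases "x i \<in> arcs cover") (auto simp: cover_reversal_eq prod_eq_iff)
  then show ?thesis by (simp only: semi_geodesics_def mem_Collect_eq)
qed

text \<open>
  The semi-geodesic that follows the branch \<open>w\<close> from the base vertex.
\<close>

definition ray :: "(nat \<Rightarrow> 'b) \<Rightarrow> nat \<Rightarrow> 'b list \<times> 'b" where
  "ray w i = (stem w i, w i)"

lemma ray_in_rays_iff: "ray w \<in> rays \<longleftrightarrow> w \<in> branches"
proof
  assume "ray w \<in> rays"
  then show "w \<in> branches"
    by (auto simp: rays_iff ray_def cover_arcs branches_def)
next
  assume w: "w \<in> branches"
  have "stem w n \<in> reduced_walks" for n
    using w by (simp add: branches_def)
  then have snoc: "stem w n @ [w n] \<in> reduced_walks" for n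
    by (metis stem_Suc)
  have "w (Suc i) \<noteq> r (w i)" for i
    using snoc[of "Suc i"] unfolding snoc_reduced_walk by (simp add: stem_Suc)
  moreover have "(stem w i, w i) \<in> arcs cover" for i
    using snoc[of i] unfolding snoc_reduced_walk cover_arcs by blast
  moreover have "reduce r (stem w i @ [w i]) = stem w (Suc i)" for i
    using snoc[of i] by (simp add: in_reduced_walks reduce_eq_self stem_Suc del: awalk_append_iff)
  ultimately show "ray w \<in> rays"
    by (simp add: rays_iff ray_def)
qed

lemma rays_shift: "x \<in> rays \<Longrightarrow> (\<lambda>i. x (k + i)) \<in> rays"
  by (simp add: rays_iff)

lemma cofinal_shift:
  assumes "x \<in> rays"
  shows "(x, \<lambda>i. x (k + i)) \<in> cofinality"
proof -
  have "\<forall>i. x (k + i) = x (k + (0 + i))" by simp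
  then show ?thesis
    using assms rays_shift[OF assms, of k] unfolding cofinal_rel_def by blast
qed

lemma equiv_cofinal: "equiv rays cofinality"
proof (rule equivI)
  show "cofinality \<subseteq> rays \<times> rays" by (auto simp: cofinal_rel_def)
  show "refl_on rays cofinality"
    by (auto simp: refl_on_def cofinal_rel_def)
  show "sym cofinality"
    unfolding sym_def cofinal_rel_def by auto metis
  show "trans cofinality"
  proof (rule transI)
    fix x y z assume "(x, y) \<in> cofinality" "(y, z) \<in> cofinality"
    then obtain m n m' n' where *: "x \<in> rays" "z \<in> rays"
      "\<And>i. x (m + i) = y (n + i)" "\<And>i. y (m' + i) = z (n' + i)"
      unfolding cofinal_rel_def by blast
    have "x ((m + m') + i) = z ((n' + n) + i)" for i
      using *(3)[of "m' + i"] *(4)[of "n + i"] by (simp add: ac_simps)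
    then show "(x, z) \<in> cofinality"
      using *(1,2) unfolding cofinal_rel_def by blast
  qed
qed

lemma cofinal_refl: "x \<in> rays \<Longrightarrow> (x, x) \<in> cofinality"
  using equiv_cofinal by (meson equivE refl_onD)

lemma cofinal_sym: "(x, y) \<in> cofinality \<Longrightarrow> (y, x) \<in> cofinality"
  using equiv_cofinal by (meson equivE symE)

lemma cofinal_trans:
  "(x, y) \<in> cofinality \<Longrightarrow> (y, z) \<in> cofinality \<Longrightarrow> (x, z) \<in> cofinality"
  using equiv_cofinal by (meson equivE transE)

text \<open>
  Along a ray from the base vertex, position and distance from the base vertex agree. Hence two such
  rays with a common tail meet without any shift, and then they coincide.
\<close>

lemma ray_cofinal_unique:
  assumes "(ray w, ray w') \<in> cofinality"
  shows "w = w'"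
proof -
  obtain m n where eq: "\<And>i. ray w (m + i) = ray w' (n + i)"
    using assms unfolding cofinal_rel_def by blast
  have "length (stem w m) = length (stem w' n)"
    using eq[of 0] by (simp add: ray_def)
  then have "m = n" by simp
  have "stem w k = stem w' k" for k
    using eq[of k] stem_mono[of w "m + k" w' k] by (simp add: ray_def \<open>m = n\<close>)
  then show ?thesis by (rule stem_ext)
qed

text \<open>
  The edge \<open>(q, e)\<close> points towards the base vertex.
\<close>

definition backward :: "'b list \<Rightarrow> 'b \<Rightarrow> bool" where
  "backward q e \<longleftrightarrow> q \<noteq> [] \<and> e = r (last q)"

text \<open>
  The criterion for the end \<open>w\<close> to lie in the cylinder of \<open>(q, e)\<close>. For an edge that points away
  from the base vertex, \<open>w\<close> must pass through that edge; for an edge that points towards the base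
  vertex, \<open>w\<close> must avoid the part of the tree beyond \<open>q\<close>.
\<close>

definition leads_to :: "'b list \<Rightarrow> 'b \<Rightarrow> (nat \<Rightarrow> 'b) \<Rightarrow> bool" where
  "leads_to q e w \<longleftrightarrow>
     (if backward q e then stem w (length q) \<noteq> q else stem w (Suc (length q)) = q @ [e])"

lemma forward_iff:
  assumes "(q, e) \<in> arcs cover"
  shows "q @ [e] \<in> reduced_walks \<longleftrightarrow> \<not> backward q e"
  using assms by (auto simp: cover_arcs snoc_reduced_walk backward_def)

lemma leads_to_unique: "leads_to q e w \<Longrightarrow> leads_to q e' w \<Longrightarrow> e = e'"
  unfolding leads_to_def backward_def by (auto simp: stem_Suc split: if_splits)

lemma backwardE:
  assumes "backward q e"
  obtains q' f where "q = q' @ [f]" "e = r f"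
  using assms unfolding backward_def by (metis append_butlast_last_id)

text \<open>
  A ray that starts away from the base vertex never turns back, so it continues the walk \<open>q\<close> from
  the base vertex to its starting point. The branch is \<open>q\<close> followed by the arcs of the ray.
\<close>

lemma end_of_forward_ray:
  assumes x: "x \<in> rays" and forward: "\<not> backward (fst (x 0)) (snd (x 0))"
  shows "\<exists>w\<in>branches. (x, ray w) \<in> cofinality \<and> leads_to (fst (x 0)) (snd (x 0)) w"
proof -
  define q where "q = fst (x 0)"
  define w where "w i = (if i < length q then q ! i else snd (x (i - length q)))" for i
  have stem_q: "stem w (length q) = q"
    by (intro nth_equalityI) (auto simp: stem_def w_def)
  have arcs: "x i \<in> arcs cover" and step: "fst (x (Suc i)) = reduce r (fst (x i) @ [snd (x i)])"
    and no_back: "snd (x (Suc i)) \<noteq> r (snd (x i))" for i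
    using x by (auto simp: rays_iff)
  have *: "fst (x i) = stem w (length q + i) \<and> \<not> backward (fst (x i)) (snd (x i))" for i
  proof (induction i)
    case 0
    then show ?case using stem_q forward by (simp add: q_def)
  next
    case (Suc i)
    then have "fst (x i) @ [snd (x i)] \<in> reduced_walks"
      using forward_iff[of "fst (x i)" "snd (x i)"] arcs[of i] by (metis prod.collapse)
    then have "fst (x (Suc i)) = fst (x i) @ [snd (x i)]"
      by (simp add: step in_reduced_walks reduce_eq_self)
    then show ?case
      using Suc no_back[of i] by (simp add: stem_Suc w_def backward_def)
  qed
  have shift: "x i = ray w (length q + i)" for i
    using *[of i] by (simp add: ray_def prod_eq_iff w_def)
  have "stem w n \<in> reduced_walks" for n
  proof -
    have "fst (x n) \<in> reduced_walks"
      using arcs[of n] cover_arcs[of "fst (x n)" "snd (x n)"] by simp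
    then have "stem w (length q + n) \<in> reduced_walks"
      using * by simp
    from take_in_tree[of "\<lambda>_. True", OF _ this, of n] show ?thesis
      by (simp add: take_stem)
  qed
  then have w: "w \<in> branches" by (simp add: branches_def)
  then have "ray w \<in> rays" by (simp add: ray_in_rays_iff)
  moreover have "x = (\<lambda>i. ray w (length q + i))"
    using shift by (rule ext)
  ultimately have "(x, ray w) \<in> cofinality"
    using cofinal_sym[OF cofinal_shift[of "ray w" "length q"]] by simp
  moreover have "leads_to (fst (x 0)) (snd (x 0)) w"
    using forward stem_q by (simp add: leads_to_def flip: q_def) (simp add: stem_Suc w_def)
  ultimately show ?thesis using w by blast
qed

text \<open>
  A ray that starts towards the base vertex becomes, after its first edge, a ray from a vertex closer
  to the base vertex; this step is repeated until the preceding lemma applies.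
\<close>

lemma end_of_ray:
  assumes "x \<in> rays"
  shows "\<exists>w\<in>branches. (x, ray w) \<in> cofinality \<and> leads_to (fst (x 0)) (snd (x 0)) w"
  using assms
proof (induction "length (fst (x 0))" arbitrary: x rule: less_induct)
  case less
  show ?case
  proof (cases "backward (fst (x 0)) (snd (x 0))")
    case False
    with less.prems show ?thesis by (rule end_of_forward_ray)
  next
    case True
    then obtain q f where q: "fst (x 0) = q @ [f]" "snd (x 0) = r f"
      by (rule backwardE)
    define y where "y i = x (1 + i)" for i
    have y: "y \<in> rays" "(x, y) \<in> cofinality"
      using rays_shift[OF less.prems, of 1] cofinal_shift[OF less.prems, of 1]
      unfolding y_def .
    have "x 0 \<in> arcs cover" "fst (y 0) = reduce r (fst (x 0) @ [snd (x 0)])"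
      and no_back: "snd (y 0) \<noteq> r (snd (x 0))"
      using less.prems unfolding rays_iff y_def by simp_all
    then have "reduced r (q @ [f])"
      using cover_arcs[of "q @ [f]" "r f"] q by (metis in_reduced_walks prod.collapse)
    then have y0: "fst (y 0) = q"
      using reduce_snoc_cancel[of q f] q \<open>fst (y 0) = _\<close> by (simp add: reduced_snoc)
    obtain w where w: "w \<in> branches" "(y, ray w) \<in> cofinality" "leads_to q (snd (y 0)) w"
      using less.hyps[OF _ y(1)] y0 q(1) by auto
    \<comment> \<open>An end beyond q @ [f] is reached from q only through f, but f would undo the first
      step of x.\<close>
    have "stem w (length (q @ [f])) \<noteq> q @ [f]"
    proof
      assume "stem w (length (q @ [f])) = q @ [f]"
      then have "stem w (length q) = q" "w (length q) = f" by (simp_all add: stem_Suc)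
      then show False
        using w(3) no_back q(2) by (auto simp: leads_to_def stem_Suc split: if_splits)
    qed
    then have "leads_to (fst (x 0)) (snd (x 0)) w"
      using True q by (simp add: leads_to_def)
    moreover have "(x, ray w) \<in> cofinality"
      using y(2) w(2) cofinal_sym cofinal_trans by blast
    ultimately show ?thesis using w(1) by blast
  qed
qed

text \<open>
  The geodesic from \<open>q @ [f]\<close> to the end \<open>w\<close> is a tail of the ray of \<open>w\<close> if \<open>w\<close> passes through
  \<open>q @ [f]\<close>. Otherwise it is the geodesic from \<open>q\<close> preceded by the edge back to \<open>q\<close>; there is no
  backtracking, since a geodesic from \<open>q\<close> that starts with \<open>f\<close> ends beyond \<open>q @ [f]\<close>.
\<close>

lemma ray_from_vertex:
  assumes q: "q \<in> reduced_walks" and w: "w \<in> branches"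
  shows "\<exists>x\<in>rays. fst (x 0) = q \<and> (x, ray w) \<in> cofinality"
  using q
proof (induction q rule: rev_induct)
  case Nil
  have "ray w \<in> rays" "fst (ray w 0) = []"
    using w by (simp_all add: ray_in_rays_iff ray_def)
  then show ?case
    using cofinal_refl by blast
next
  case (snoc f q)
  show ?case
  proof (cases "stem w (Suc (length q)) = q @ [f]")
    case True
    have "ray w \<in> rays" using w by (simp add: ray_in_rays_iff)
    then have "(\<lambda>i. ray w (Suc (length q) + i)) \<in> rays"
        "((\<lambda>i. ray w (Suc (length q) + i)), ray w) \<in> cofinality"
      by (rule rays_shift, rule cofinal_sym[OF cofinal_shift])
    moreover have "fst (ray w (Suc (length q) + 0)) = q @ [f]"
      using True by (simp add: ray_def)
    ultimately show ?thesis
      by (intro bexI[of _ "\<lambda>i. ray w (Suc (length q) + i)"] conjI)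
  next
    case False
    have f: "q \<in> reduced_walks" "f \<in> arcs G" "tail G f = tip q" "\<not> backward q f"
      using snoc.prems by (auto simp: snoc_reduced_walk backward_def)
    then obtain y where y: "y \<in> rays" "fst (y 0) = q" "(y, ray w) \<in> cofinality"
      using snoc.IH by blast
    obtain w' where w': "(y, ray w') \<in> cofinality" "leads_to q (snd (y 0)) w'"
      using end_of_ray[OF y(1)] y(2) by blast
    have "(ray w, ray w') \<in> cofinality"
      using y(3) w'(1) cofinal_sym cofinal_trans by blast
    then have "w' = w" using ray_cofinal_unique by blast
    then have ne: "snd (y 0) \<noteq> f"
      using w'(2) False f(4) by (auto simp: leads_to_def)
    define x where "x = case_nat (q @ [f], r f) y"
    have "reduce r ((q @ [f]) @ [r f]) = q"
      using reduce_snoc_cancel[of q f] f(1) by (simp add: in_reduced_walks)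
    moreover have "(q @ [f], r f) \<in> arcs cover"
      using snoc.prems f by (simp add: cover_arcs del: awalk_verts.simps)
    ultimately have "x \<in> rays"
      using y(1,2) ne unfolding rays_iff x_def by (auto split: nat.splits)
    moreover have "(\<lambda>i. x (1 + i)) = y" by (simp add: x_def)
    ultimately have "(x, y) \<in> cofinality"
      using cofinal_shift[of x 1] by simp
    then have "(x, ray w) \<in> cofinality"
      using y(3) cofinal_sym cofinal_trans by blast
    then show ?thesis
      using \<open>x \<in> rays\<close> by (intro bexI[of _ x]) (simp_all add: x_def)
  qed
qed

definition endpoint :: "(nat \<Rightarrow> 'b) \<Rightarrow> (nat \<Rightarrow> 'b list \<times> 'b) set" where
  "endpoint w = cofinality `` {ray w}"

lemma inj_on_endpoint: "inj_on endpoint branches"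
proof (rule inj_onI)
  fix w w' assume w: "w \<in> branches" "w' \<in> branches" "endpoint w = endpoint w'"
  then have "(ray w, ray w') \<in> cofinality"
    using equiv_cofinal unfolding endpoint_def
    by (simp add: eq_equiv_class_iff ray_in_rays_iff)
  then show "w = w'" by (rule ray_cofinal_unique)
qed

lemma boundary_eq: "boundary = endpoint ` branches"
proof (intro equalityI subsetI)
  fix \<omega> assume "\<omega> \<in> boundary"
  then obtain x where x: "x \<in> rays" "\<omega> = cofinality `` {x}"
    unfolding tree_boundary_def by (rule quotientE)
  obtain w where "w \<in> branches" "(x, ray w) \<in> cofinality"
    using end_of_ray[OF x(1)] by blast
  then show "\<omega> \<in> endpoint ` branches"
    using x equiv_class_eq[OF equiv_cofinal] unfolding endpoint_def by blast
next
  fix \<omega> assume "\<omega> \<in> endpoint ` branches"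
  then show "\<omega> \<in> boundary"
    unfolding tree_boundary_def endpoint_def using ray_in_rays_iff by (auto intro: quotientI)
qed

lemma endpoint_in_cylinder_iff:
  assumes d: "(q, e) \<in> arcs cover" and w: "w \<in> branches"
  shows "endpoint w \<in> cylinder (q, e) \<longleftrightarrow> leads_to q e w"
proof
  assume "endpoint w \<in> cylinder (q, e)"
  then obtain x where x: "(ray w, x) \<in> cofinality" "x 0 = (q, e)"
    unfolding boundary_cylinder_def endpoint_def by blast
  then have "x \<in> rays" by (simp add: cofinal_rel_def)
  then obtain w' where w': "(x, ray w') \<in> cofinality" "leads_to q e w'"
    using end_of_ray[of x] x(2) by auto
  have "(ray w, ray w') \<in> cofinality"
    using x(1) w'(1) cofinal_sym cofinal_trans by blast
  with w'(2) show "leads_to q e w" using ray_cofinal_unique by blast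
next
  assume l: "leads_to q e w"
  obtain x where x: "x \<in> rays" "fst (x 0) = q" "(x, ray w) \<in> cofinality"
    using ray_from_vertex[of q w] d w by (auto simp: cover_arcs)
  obtain w' where w': "(x, ray w') \<in> cofinality" "leads_to q (snd (x 0)) w'"
    using end_of_ray[OF x(1)] x(2) by blast
  have wx: "(ray w, x) \<in> cofinality" and "(ray w, ray w') \<in> cofinality"
    using x(3) w'(1) cofinal_sym cofinal_trans by blast+
  then have "w' = w" using ray_cofinal_unique by blast
  then have "x 0 = (q, e)"
    using l w'(2) leads_to_unique x(2) by (metis prod.collapse)
  with wx show "endpoint w \<in> cylinder (q, e)"
    using w boundary_eq unfolding boundary_cylinder_def endpoint_def by blast
qed

lemma cylinder_subset: "cylinder d \<subseteq> boundary"
  by (auto simp: boundary_cylinder_def)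

lemma cylinder_eq:
  "(q, e) \<in> arcs cover \<Longrightarrow> cylinder (q, e) = endpoint ` {w \<in> branches. leads_to q e w}"
  using endpoint_in_cylinder_iff[of q e] cylinder_subset[of "(q, e)"] unfolding boundary_eq by blast

lemma cylinder_forward:
  assumes "q @ [e] \<in> reduced_walks"
  shows "cylinder (q, e) = endpoint ` {w \<in> branches. stem w (length (q @ [e])) = q @ [e]}"
proof -
  have "(q, e) \<in> arcs cover" using assms by (simp add: cover_arcs snoc_reduced_walk)
  then show ?thesis
    using assms forward_iff[of q e] by (simp add: cylinder_eq leads_to_def)
qed

lemma boundary_eq_Union_cylinders:
  assumes q: "q \<in> reduced_walks"
  shows "boundary = (\<Union>e\<in>out_arcs G (tip q). cylinder (q, e))"
proof (intro equalityI subsetI)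
  fix \<omega> assume "\<omega> \<in> boundary"
  then obtain w where w: "w \<in> branches" "\<omega> = endpoint w" by (auto simp: boundary_eq)
  obtain x where x: "x \<in> rays" "fst (x 0) = q" "(x, ray w) \<in> cofinality"
    using ray_from_vertex[OF q w(1)] by blast
  obtain e where e: "x 0 = (q, e)" using x(2) by (metis prod.collapse)
  then have "e \<in> out_arcs G (tip q)"
    using x(1) cover_arcs[of q e] unfolding rays_iff by (metis in_out_arcs_conv)
  moreover have "(ray w, x) \<in> cofinality"
    using x(3) cofinal_sym cofinal_trans by blast
  then have "\<omega> \<in> cylinder (q, e)"
    using w e boundary_eq unfolding boundary_cylinder_def endpoint_def by blast
  ultimately show "\<omega> \<in> (\<Union>e\<in>out_arcs G (tip q). cylinder (q, e))" by blast
qed (use cylinder_subset in blast)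

lemma disjoint_cylinders:
  assumes q: "q \<in> reduced_walks"
  shows "disjoint_family_on (\<lambda>e. cylinder (q, e)) (out_arcs G (tip q))"
  unfolding disjoint_family_on_def
proof (intro ballI impI)
  fix e e' assume e: "e \<in> out_arcs G (tip q)" "e' \<in> out_arcs G (tip q)" "e \<noteq> e'"
  then have d: "(q, e) \<in> arcs cover" "(q, e') \<in> arcs cover"
    using q by (auto simp: cover_arcs)
  show "cylinder (q, e) \<inter> cylinder (q, e') = {}"
  proof (rule ccontr)
    assume "cylinder (q, e) \<inter> cylinder (q, e') \<noteq> {}"
    then obtain w where "w \<in> branches" "endpoint w \<in> cylinder (q, e)"
        "endpoint w \<in> cylinder (q, e')"
      using cylinder_subset unfolding boundary_eq by blast
    then have "leads_to q e w" "leads_to q e' w"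
      using d endpoint_in_cylinder_iff by blast+
    with e(3) show False using leads_to_unique by blast
  qed
qed

lemma reversal_in_cover:
  assumes "(q, e) \<in> arcs cover"
  shows "(reduce r (q @ [e]), r e) \<in> arcs cover"
proof -
  have q: "awalk v q (tip q)" "e \<in> arcs G" "tail G e = tip q"
    using assms by (simp_all add: cover_arcs in_reduced_walks)
  then have "awalk v (q @ [e]) (head G e)"
    using arc_implies_awalk[of e] by (metis awalk_appendI)
  from reduce_reduced_walk[OF this] show ?thesis
    using q(2) unfolding cover_arcs by simp
qed

text \<open>
  In each case of \<open>leads_to\<close>, reversing the edge negates the condition.
\<close>

lemma cylinder_reversal:
  assumes d: "(q, e) \<in> arcs cover"
  shows "cylinder (reduce r (q @ [e]), r e) = boundary - cylinder (q, e)"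
proof -
  have *: "leads_to (reduce r (q @ [e])) (r e) w \<longleftrightarrow> \<not> leads_to q e w" for w
  proof (cases "backward q e")
    case True
    then obtain q' f where q': "q = q' @ [f]" "e = r f" by (rule backwardE)
    have "reduced r (q' @ [f])" using d q' by (simp add: cover_arcs in_reduced_walks)
    then have "reduce r (q @ [e]) = q'" "\<not> backward q' f"
      using q' reduce_snoc_cancel[of q' f] by (auto simp: reduced_snoc backward_def)
    then show ?thesis using True q' by (simp add: leads_to_def)
  next
    case False
    then have "reduce r (q @ [e]) = q @ [e]"
      using forward_iff[OF d] by (simp add: in_reduced_walks reduce_eq_self)
    moreover have "backward (q @ [e]) (r e)" by (simp add: backward_def)
    ultimately show ?thesis using False by (simp add: leads_to_def)
  qed
  show ?thesis
    using endpoint_in_cylinder_iff[OF d] endpoint_in_cylinder_iff[OF reversal_in_cover[OF d]]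
      cylinder_subset[of "(reduce r (q @ [e]), r e)"] * unfolding boundary_eq by blast
qed

section \<open>Clopen sets of ends\<close>

definition ends :: "(nat \<Rightarrow> 'b list \<times> 'b) set set \<Rightarrow> (nat \<Rightarrow> 'b) set" where
  "ends A = {w \<in> branches. endpoint w \<in> A}"

lemma ends_subset: "ends A \<subseteq> branches"
  by (auto simp: ends_def)

lemma ends_Un: "ends (A \<union> B) = ends A \<union> ends B"
  by (auto simp: ends_def)

lemma topspace_boundary: "topspace boundary_space = boundary"
proof -
  have "boundary \<subseteq> (\<Union>d\<in>arcs cover. cylinder d)"
  proof
    fix \<omega> assume "\<omega> \<in> boundary"
    then obtain e where "e \<in> out_arcs G v" "\<omega> \<in> cylinder ([], e)"
      using boundary_eq_Union_cylinders[OF Nil_reduced_walk] by auto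
    then show "\<omega> \<in> (\<Union>d\<in>arcs cover. cylinder d)"
      by (intro UN_I[of "([], e)"]) (auto simp: cover_arcs)
  qed
  then show ?thesis
    using cylinder_subset by (auto simp: boundary_topology_def)
qed

lemma open_cylinder: "d \<in> arcs cover \<Longrightarrow> openin boundary_space (cylinder d)"
  by (simp add: boundary_topology_def topology_generated_by_Basis)

lemma clopen_cylinder:
  assumes "d \<in> arcs cover"
  shows "cylinder d \<in> clopens boundary_space"
proof -
  obtain q e where d: "d = (q, e)" by (cases d)
  have "openin boundary_space (boundary - cylinder d)"
    using assms open_cylinder[OF reversal_in_cover[of q e]] cylinder_reversal[of q e] d by simp
  then show ?thesis
    using assms open_cylinder cylinder_subset[of d]
    by (simp add: clopens_def closedin_def topspace_boundary)
qed

lemma clopen_Un: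
  "A \<in> clopens X \<Longrightarrow> B \<in> clopens X \<Longrightarrow> A \<union> B \<in> clopens X"
  by (auto simp: clopens_def)

lemma clopen_boundary: "boundary \<in> clopens boundary_space"
  unfolding topspace_boundary[symmetric] by (simp add: clopens_def)

lemma leads_to_stem_cong:
  "stem w' (Suc (length q)) = stem w (Suc (length q)) \<Longrightarrow> leads_to q e w' \<longleftrightarrow> leads_to q e w"
  using stem_mono[of w' "Suc (length q)" w "length q"] by (simp add: leads_to_def)

text \<open>
  Whether an end lies in the cylinder of \<open>(q, e)\<close> is decided by its first \<open>length q + 1\<close> arcs. So the
  topology generated by all cylinders, including those of edges that point towards the base vertex,
  is not finer than the one given by initial segments.
\<close>

lemma open_imp_locally_determined:
  assumes "openin boundary_space A" "w \<in> branches" "endpoint w \<in> A"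
  shows "\<exists>n. \<forall>w'\<in>branches. stem w' n = stem w n \<longrightarrow> endpoint w' \<in> A"
proof -
  have "generate_topology_on (cylinder ` arcs cover) A"
    using assms(1) by (simp add: boundary_topology_def openin_topology_generated_by_iff)
  then show ?thesis
    using assms(3)
  proof induction
    case (Int A B)
    then obtain m n where
      m: "\<forall>w'\<in>branches. stem w' m = stem w m \<longrightarrow> endpoint w' \<in> A" and
      n: "\<forall>w'\<in>branches. stem w' n = stem w n \<longrightarrow> endpoint w' \<in> B"
      by blast
    show ?case
    proof (intro exI ballI impI)
      fix w' assume "w' \<in> branches" "stem w' (max m n) = stem w (max m n)"
      moreover from this have "stem w' m = stem w m" "stem w' n = stem w n"
        by (auto elim: stem_mono)
      ultimately show "endpoint w' \<in> A \<inter> B" using m n by blast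
    qed
  next
    case (UN K)
    then show ?case by blast
  next
    case (Basis A)
    then obtain q e where d: "(q, e) \<in> arcs cover" "A = cylinder (q, e)" by auto
    then have "leads_to q e w"
      using Basis.prems assms(2) endpoint_in_cylinder_iff by blast
    then have "\<forall>w'\<in>branches. stem w' (Suc (length q)) = stem w (Suc (length q)) \<longrightarrow>
        endpoint w' \<in> A"
      using d endpoint_in_cylinder_iff leads_to_stem_cong by blast
    then show ?case ..
  qed simp
qed

lemma clopen_determined:
  assumes "A \<in> clopens boundary_space"
  shows "\<exists>n. determined n (ends A)"
proof (rule locally_constant_imp_determined)
  fix w assume w: "w \<in> branches"
  have A: "openin boundary_space A" "openin boundary_space (boundary - A)"
    using assms by (auto simp: clopens_def closedin_def topspace_boundary)
  show "\<exists>n. \<forall>w'\<in>branches. stem w' n = stem w n \<longrightarrow> (w' \<in> ends A \<longleftrightarrow> w \<in> ends A)"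
  proof (cases "endpoint w \<in> A")
    case True
    then show ?thesis
      using open_imp_locally_determined[OF A(1) w] w by (auto simp: ends_def)
  next
    case False
    then have "endpoint w \<in> boundary - A" using w by (auto simp: boundary_eq)
    from open_imp_locally_determined[OF A(2) w this] False show ?thesis
      by (auto simp: ends_def)
  qed
qed

lemma cylinder_ray:
  assumes "w \<in> branches"
  shows "ray w n \<in> arcs cover"
    and "cylinder (ray w n) = endpoint ` {w' \<in> branches. stem w' (Suc n) = stem w (Suc n)}"
proof -
  have "stem w n @ [w n] \<in> reduced_walks"
    using assms stem_Suc[of w n] by (metis (mono_tags) branches_def mem_Collect_eq)
  then show "ray w n \<in> arcs cover"
      "cylinder (ray w n) = endpoint ` {w' \<in> branches. stem w' (Suc n) = stem w (Suc n)}"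
    using cylinder_forward[of "stem w n" "w n"]
    by (auto simp only: ray_def cover_arcs snoc_reduced_walk stem_Suc length_append length_stem
        list.size add_0_right add_Suc_right)
qed

text \<open>
  If the first \<open>n\<close> arcs determine \<open>A\<close>, take the edges through which the ends in \<open>A\<close> continue after
  \<open>n\<close> arcs. The additional arc covers the case \<open>n = 0\<close>, where the stem itself contains no edge to
  which a cylinder could belong.
\<close>

lemma clopen_decomposition:
  assumes A: "A \<in> clopens boundary_space"
  obtains D where "finite D" "D \<subseteq> arcs cover" "disjoint_family_on cylinder D"
    "A = (\<Union>d\<in>D. cylinder d)"
proof -
  obtain n where "determined n (ends A)" using clopen_determined[OF A] ..
  then have det: "determined (Suc n) (ends A)" by (rule determined_mono) simp
  define D where "D = (\<lambda>w. ray w n) ` ends A"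
  have A_eq: "A = endpoint ` ends A"
    using A openin_subset[of boundary_space A]
    by (auto simp: ends_def clopens_def topspace_boundary boundary_eq)
  show thesis
  proof
    have "D = (\<lambda>p. (butlast p, last p)) ` (\<lambda>w. stem w (Suc n)) ` ends A"
      by (simp add: D_def image_image stem_Suc ray_def)
    then show "finite D" using finite_stems[OF ends_subset] by simp
    show "D \<subseteq> arcs cover"
      unfolding D_def using cylinder_ray(1) ends_subset by blast
    show "disjoint_family_on cylinder D"
      unfolding disjoint_family_on_def
    proof (intro ballI impI)
      fix d d' assume d: "d \<in> D" "d' \<in> D" "d \<noteq> d'"
      then obtain w w' where w: "w \<in> branches" "d = ray w n" "w' \<in> branches" "d' = ray w' n"
        using ends_subset by (auto simp: D_def)
      have "stem w (Suc n) \<noteq> stem w' (Suc n)"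
        using d(3) w by (auto simp: ray_def stem_Suc)
      then have "{u \<in> branches. stem u (Suc n) = stem w (Suc n)} \<inter>
          {u \<in> branches. stem u (Suc n) = stem w' (Suc n)} = {}"
        by auto
      then show "cylinder d \<inter> cylinder d' = {}"
        using w cylinder_ray(2) inj_on_image_Int[OF inj_on_endpoint] by (metis (no_types, lifting) image_empty mem_Collect_eq subsetI)
    qed
    have "ends A = (\<Union>w\<in>ends A. {w' \<in> branches. stem w' (Suc n) = stem w (Suc n)})"
      using det ends_subset[of A] unfolding determined_def by blast
    then have "A = (\<Union>w\<in>ends A. endpoint ` {w' \<in> branches. stem w' (Suc n) = stem w (Suc n)})"
      using A_eq by (metis image_UN)
    then show "A = (\<Union>d\<in>D. cylinder d)"
      using cylinder_ray(2) ends_subset[of A] by (simp add: D_def subset_iff)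
  qed
qed

lemma distribution_eqI:
  assumes \<mu>: "\<mu> \<in> distributions boundary_space" and \<nu>: "\<nu> \<in> distributions boundary_space"
    and eq: "\<And>d. d \<in> arcs cover \<Longrightarrow> \<mu> (cylinder d) = \<nu> (cylinder d)"
  shows "\<mu> = \<nu>"
proof
  fix A
  show "\<mu> A = \<nu> A"
  proof (cases "A \<in> clopens boundary_space")
    case True
    then obtain D where D: "finite D" "D \<subseteq> arcs cover" "disjoint_family_on cylinder D"
        "A = (\<Union>d\<in>D. cylinder d)"
      by (rule clopen_decomposition)
    then have "\<mu> A = (\<Sum>d\<in>D. \<mu> (cylinder d))" "\<nu> A = (\<Sum>d\<in>D. \<nu> (cylinder d))"
      using distribution_UN[OF \<mu>, of D cylinder] distribution_UN[OF \<nu>, of D cylinder]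
        clopen_cylinder by blast+
    moreover have "(\<Sum>d\<in>D. \<mu> (cylinder d)) = (\<Sum>d\<in>D. \<nu> (cylinder d))"
      using eq D(2) by (intro sum.cong) blast+
    ultimately show ?thesis by simp
  next
    case False
    then show ?thesis using \<mu> \<nu> by (simp add: distributions_def)
  qed
qed

section \<open>The action of the fundamental group\<close>

lemma fundamental_group_carrier:
  "g \<in> carrier (fundamental_group G r v) \<longleftrightarrow> awalk v g v \<and> reduced r g"
  by (simp add: fundamental_group_def)

lemma act_arcs:
  assumes g: "awalk v g v" and d: "d \<in> arcs cover"
  shows "cover_act r g d \<in> arcs cover"
proof -
  obtain q e where qe: "d = (q, e)" by (cases d)
  have "awalk v (g @ q) (tip q)"
    using g d unfolding qe cover_arcs in_reduced_walks by (blast intro: awalk_appendI)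
  from reduce_reduced_walk[OF this] show ?thesis
    using d unfolding qe cover_act_def by (simp add: cover_arcs)
qed

lemma act_inverse:
  assumes "d \<in> arcs cover"
  shows "cover_act r (formal_inverse g) (cover_act r g d) = d"
  using assms reduce_inverse_act[of "fst d" g] cover_arcs[of "fst d" "snd d"]
  by (simp add: cover_act_def case_prod_unfold in_reduced_walks)

lemma act_rays:
  assumes g: "awalk v g v" and x: "x \<in> rays"
  shows "cover_act r g \<circ> x \<in> rays"
  unfolding rays_iff
proof (intro allI conjI)
  fix i
  have x_i: "x i \<in> arcs cover" "fst (x (Suc i)) = reduce r (fst (x i) @ [snd (x i)])"
      "snd (x (Suc i)) \<noteq> r (snd (x i))"
    using x by (auto simp: rays_iff)
  show "(cover_act r g \<circ> x) i \<in> arcs cover"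
    using act_arcs[OF g x_i(1)] by simp
  have "reduce r (g @ fst (x (Suc i))) = reduce r (reduce r (g @ fst (x i)) @ [snd (x i)])"
    by (simp only: x_i(2) reduce_append_right reduce_append_left append_assoc)
  then show "fst ((cover_act r g \<circ> x) (Suc i)) =
      reduce r (fst ((cover_act r g \<circ> x) i) @ [snd ((cover_act r g \<circ> x) i)])"
    by (simp add: cover_act_def case_prod_unfold)
  show "snd ((cover_act r g \<circ> x) (Suc i)) \<noteq> r (snd ((cover_act r g \<circ> x) i))"
    using x_i(3) by (simp add: cover_act_def case_prod_unfold)
qed

lemma act_inverse_ray:
  assumes "x \<in> rays"
  shows "cover_act r (formal_inverse g) \<circ> (cover_act r g \<circ> x) = x"
proof
  fix i
  have "x i \<in> arcs cover" using assms by (simp add: rays_iff)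
  then show "(cover_act r (formal_inverse g) \<circ> (cover_act r g \<circ> x)) i = x i"
    by (simp add: act_inverse)
qed

lemma act_cofinal:
  assumes g: "awalk v g v" and "(x, y) \<in> cofinality"
  shows "(cover_act r g \<circ> x, cover_act r g \<circ> y) \<in> cofinality"
proof -
  obtain m n where "x \<in> rays" "y \<in> rays" "\<forall>i. x (m + i) = y (n + i)"
    using assms(2) unfolding cofinal_rel_def by blast
  moreover from this(3) have
    "\<forall>i. (cover_act r g \<circ> x) (m + i) = (cover_act r g \<circ> y) (n + i)" by simp
  ultimately show ?thesis
    using act_rays[OF g] unfolding cofinal_rel_def by blast
qed

text \<open>
  The image of a class is a full class, since the inverse transformation carries every ray cofinal to
  the image back into the class.
\<close>

lemma boundary_act_class:
  assumes g: "awalk v g v" and x: "x \<in> rays"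
  shows "boundary_act (cover_act r g) (cofinality `` {x}) = cofinality `` {cover_act r g \<circ> x}"
proof (intro equalityI subsetI)
  fix y assume "y \<in> boundary_act (cover_act r g) (cofinality `` {x})"
  then show "y \<in> cofinality `` {cover_act r g \<circ> x}"
    using act_cofinal[OF g] unfolding boundary_act_def by blast
next
  fix y assume y: "y \<in> cofinality `` {cover_act r g \<circ> x}"
  let ?h = "cover_act r (formal_inverse g)"
  have "y \<in> rays" using y by (simp add: cofinal_rel_def)
  then have "y = cover_act r g \<circ> (?h \<circ> y)"
    using act_inverse_ray[of y "formal_inverse g"] by simp
  moreover have "(?h \<circ> (cover_act r g \<circ> x), ?h \<circ> y) \<in> cofinality"
    using y act_cofinal[OF awalk_formal_inverse[OF g]] by blast
  then have "?h \<circ> y \<in> cofinality `` {x}"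
    using act_inverse_ray[OF x] by simp
  ultimately show "y \<in> boundary_act (cover_act r g) (cofinality `` {x})"
    unfolding boundary_act_def by blast
qed

lemma boundaryE:
  assumes "\<omega> \<in> boundary"
  obtains x where "x \<in> rays" "\<omega> = cofinality `` {x}"
  using assms unfolding tree_boundary_def by (rule quotientE)

lemma boundary_act_inverse:
  assumes g: "awalk v g v" and "\<omega> \<in> boundary"
  shows "boundary_act (cover_act r (formal_inverse g)) (boundary_act (cover_act r g) \<omega>) = \<omega>"
proof -
  obtain x where x: "x \<in> rays" "\<omega> = cofinality `` {x}" using assms(2) by (rule boundaryE)
  show ?thesis
    unfolding x(2) boundary_act_class[OF g x(1)]
      boundary_act_class[OF awalk_formal_inverse[OF g] act_rays[OF g x(1)]]
      act_inverse_ray[OF x(1)] ..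
qed

lemma boundary_act_in_cylinder:
  assumes g: "awalk v g v" and "\<omega> \<in> cylinder d"
  shows "boundary_act (cover_act r g) \<omega> \<in> cylinder (cover_act r g d)"
proof -
  obtain x where x: "\<omega> \<in> boundary" "x \<in> \<omega>" "x 0 = d"
    using assms(2) by (auto simp: boundary_cylinder_def)
  obtain y where y: "y \<in> rays" "\<omega> = cofinality `` {y}" using x(1) by (rule boundaryE)
  have "boundary_act (cover_act r g) \<omega> \<in> boundary"
    unfolding y(2) boundary_act_class[OF g y(1)] tree_boundary_def
    by (rule quotientI[OF act_rays[OF g y(1)]])
  moreover have "cover_act r g \<circ> x \<in> boundary_act (cover_act r g) \<omega>"
    using x(2) by (simp add: boundary_act_def)
  moreover have "(cover_act r g \<circ> x) 0 = cover_act r g d"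
    using x(3) by simp
  ultimately show ?thesis unfolding boundary_cylinder_def by blast
qed

lemma boundary_act_cylinder:
  assumes g: "awalk v g v" and d: "d \<in> arcs cover"
  shows "boundary_act (cover_act r g) ` cylinder d = cylinder (cover_act r g d)"
proof (intro equalityI subsetI)
  fix \<omega> assume \<omega>: "\<omega> \<in> cylinder (cover_act r g d)"
  let ?h = "formal_inverse g"
  have h: "awalk v ?h v" by (rule awalk_formal_inverse[OF g])
  have "boundary_act (cover_act r ?h) \<omega> \<in> cylinder d"
    using boundary_act_in_cylinder[OF h \<omega>] act_inverse[OF d] by simp
  moreover have "\<omega> = boundary_act (cover_act r g) (boundary_act (cover_act r ?h) \<omega>)"
    using boundary_act_inverse[OF h subsetD[OF cylinder_subset \<omega>]]
    unfolding formal_inverse_invol by (rule sym)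
  ultimately show "\<omega> \<in> boundary_act (cover_act r g) ` cylinder d" by blast
qed (use boundary_act_in_cylinder[OF g] in blast)

lemma inj_on_boundary_act:
  assumes g: "awalk v g v"
  shows "inj_on (boundary_act (cover_act r g)) boundary"
  using boundary_act_inverse[OF g] by (rule inj_on_inverseI)

lemma vertex_lift:
  assumes "w \<in> verts G"
  obtains q where "q \<in> reduced_walks" "tip q = w"
proof -
  have "v \<rightarrow>\<^sup>*\<^bsub>mk_symmetric G\<^esub> w"
    using connected assms base unfolding Digraph_Component.connected_def strongly_connected_def
    by simp
  then have "v \<rightarrow>\<^sup>*\<^bsub>G\<^esub> w"
    using reachable_mk_symmetric_eq[OF sym_arcs] by blast
  then obtain p where "awalk v p w" by (auto simp: reachable_awalk)
  from reduce_reduced_walk[OF this] that show thesis by blast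
qed

lemma arc_lift:
  assumes "e \<in> arcs G"
  obtains q where "(q, e) \<in> arcs cover"
  using vertex_lift[of "tail G e"] assms by (metis cover_arcs tail_in_verts)

text \<open>
  The deck transformation that carries one lift to the other goes out along \<open>q'\<close> and returns along
  \<open>q\<close>.
\<close>

lemma lifts_equivalent:
  assumes "(q, e) \<in> arcs cover" "(q', e) \<in> arcs cover"
  obtains g where "g \<in> carrier (fundamental_group G r v)" "cover_act r g (q, e) = (q', e)"
proof -
  define g where "g = reduce r (q' @ formal_inverse q)"
  have q: "awalk v q (tail G e)" "awalk v q' (tail G e)" "reduced r q'"
    using assms by (simp_all add: cover_arcs in_reduced_walks)
  then have "awalk v (q' @ formal_inverse q) v"
    using awalk_formal_inverse by (metis awalk_appendI)
  then have "g \<in> carrier (fundamental_group G r v)"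
    by (simp only: g_def fundamental_group_carrier awalk_reduce reduced_reduce)
  moreover have "reduce r (g @ q) = reduce r (q' @ reduce r (formal_inverse q @ q))"
    by (simp only: g_def reduce_append_left reduce_append_right append_assoc)
  then have "cover_act r g (q, e) = (q', e)"
    using q(3) by (simp add: cover_act_def reduce_formal_inverse_left reduce_eq_self)
  ultimately show thesis by (rule that)
qed

section \<open>Invariant distributions as flows\<close>

lemma in_invariant_distributions:
  "\<mu> \<in> carrier (invariant_distributions G r v) \<longleftrightarrow> \<mu> \<in> distributions boundary_space \<and>
    (\<forall>g\<in>carrier (fundamental_group G r v). \<forall>A\<in>clopens boundary_space.
      \<mu> (boundary_act (cover_act r g) ` A) = \<mu> A)"
  by (simp add: invariant_distributions_def Let_def)

text \<open>
  Clopen sets are finite disjoint unions of cylinders, and the action permutes cylinders and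
  preserves disjointness.
\<close>

lemma invariant_if_invariant_on_cylinders:
  assumes \<mu>: "\<mu> \<in> distributions boundary_space"
    and inv: "\<And>d g. d \<in> arcs cover \<Longrightarrow> g \<in> carrier (fundamental_group G r v) \<Longrightarrow>
      \<mu> (cylinder (cover_act r g d)) = \<mu> (cylinder d)"
  shows "\<mu> \<in> carrier (invariant_distributions G r v)"
  unfolding in_invariant_distributions
proof (intro conjI ballI \<mu>)
  fix g A assume g: "g \<in> carrier (fundamental_group G r v)" and A: "A \<in> clopens boundary_space"
  then have gw: "awalk v g v" by (simp add: fundamental_group_carrier)
  obtain D where D: "finite D" "D \<subseteq> arcs cover" "disjoint_family_on cylinder D"
      "A = (\<Union>d\<in>D. cylinder d)"
    using A by (rule clopen_decomposition)
  have act_D: "boundary_act (cover_act r g) ` cylinder d = cylinder (cover_act r g d)"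
    if "d \<in> D" for d
    using that D(2) boundary_act_cylinder[OF gw] by blast
  have "disjoint_family_on (\<lambda>d. cylinder (cover_act r g d)) D"
    unfolding disjoint_family_on_def
  proof (intro ballI impI)
    fix d d' assume d: "d \<in> D" "d' \<in> D" "d \<noteq> d'"
    then have "cylinder d \<inter> cylinder d' = {}" using D(3) by (simp add: disjoint_family_on_def)
    then show "cylinder (cover_act r g d) \<inter> cylinder (cover_act r g d') = {}"
      using act_D d inj_on_image_Int[OF inj_on_boundary_act[OF gw] cylinder_subset cylinder_subset]
      by (metis image_empty)
  qed
  then have "\<mu> (\<Union>d\<in>D. cylinder (cover_act r g d)) = (\<Sum>d\<in>D. \<mu> (cylinder (cover_act r g d)))"
    using D(1,2) clopen_cylinder act_arcs[OF gw] by (intro distribution_UN[OF \<mu>]) blast+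
  also have "\<dots> = (\<Sum>d\<in>D. \<mu> (cylinder d))"
    using D(2) inv g by (intro sum.cong) blast+
  also have "\<dots> = \<mu> A"
    unfolding D(4) using D(1-3) clopen_cylinder by (intro distribution_UN[OF \<mu>, symmetric]) blast+
  also have "(\<Union>d\<in>D. cylinder (cover_act r g d)) = boundary_act (cover_act r g) ` A"
    unfolding D(4) image_UN using act_D by simp
  finally show "\<mu> (boundary_act (cover_act r g) ` A) = \<mu> A" .
qed

text \<open>
  The chosen lift does not matter for an invariant \<open>\<mu>\<close>, see \<open>arc_mass_eq\<close>.
\<close>

definition arc_mass :: "((nat \<Rightarrow> 'b list \<times> 'b) set set \<Rightarrow> int) \<Rightarrow> 'b \<Rightarrow> int" where
  "arc_mass \<mu> e = \<mu> (cylinder (SOME q. (q, e) \<in> arcs cover, e))"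

context
  fixes \<mu>
  assumes \<mu>: "\<mu> \<in> carrier (invariant_distributions G r v)"
begin

lemma distribution: "\<mu> \<in> distributions boundary_space"
  using \<mu> by (simp add: in_invariant_distributions)

lemma arc_mass_eq:
  assumes "(q, e) \<in> arcs cover"
  shows "\<mu> (cylinder (q, e)) = arc_mass \<mu> e"
proof -
  let ?q = "SOME q. (q, e) \<in> arcs cover"
  have "(?q, e) \<in> arcs cover" using assms by (rule someI)
  then obtain g where g: "g \<in> carrier (fundamental_group G r v)" "cover_act r g (?q, e) = (q, e)"
    using assms by (rule lifts_equivalent)
  then have "boundary_act (cover_act r g) ` cylinder (?q, e) = cylinder (q, e)"
    using boundary_act_cylinder[of g "(?q, e)"] \<open>(?q, e) \<in> arcs cover\<close>
    by (simp add: fundamental_group_carrier)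
  moreover have "cylinder (?q, e) \<in> clopens boundary_space"
    by (rule clopen_cylinder) fact
  ultimately show ?thesis
    using \<mu> g(1) unfolding in_invariant_distributions arc_mass_def by metis
qed

lemma arc_mass_sum:
  assumes "w \<in> verts G"
  shows "(\<Sum>e\<in>out_arcs G w. arc_mass \<mu> e) = \<mu> boundary"
proof -
  obtain q where q: "q \<in> reduced_walks" "tip q = w" using assms by (rule vertex_lift)
  have arcs: "(q, e) \<in> arcs cover" if "e \<in> out_arcs G w" for e
    using that q by (simp add: cover_arcs)
  have "\<mu> boundary = \<mu> (\<Union>e\<in>out_arcs G w. cylinder (q, e))"
    using boundary_eq_Union_cylinders[OF q(1)] q(2) by simp
  also have "\<dots> = (\<Sum>e\<in>out_arcs G w. \<mu> (cylinder (q, e)))"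
    using disjoint_cylinders[OF q(1)] arcs clopen_cylinder unfolding q(2)
    by (intro distribution_UN[OF distribution]) (blast | simp)+
  also have "\<dots> = (\<Sum>e\<in>out_arcs G w. arc_mass \<mu> e)"
    using arcs arc_mass_eq by (intro sum.cong) blast+
  finally show ?thesis ..
qed

lemma arc_mass_reverse:
  assumes "e \<in> arcs G"
  shows "arc_mass \<mu> e + arc_mass \<mu> (r e) = \<mu> boundary"
proof -
  obtain q where d: "(q, e) \<in> arcs cover" using assms by (rule arc_lift)
  let ?d' = "(reduce r (q @ [e]), r e)"
  have "cylinder (q, e) \<union> cylinder ?d' = boundary" "cylinder (q, e) \<inter> cylinder ?d' = {}"
    using cylinder_reversal[OF d] cylinder_subset[of "(q, e)"] by auto
  then have "\<mu> boundary = \<mu> (cylinder (q, e)) + \<mu> (cylinder ?d')"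
    using distribution_Un[OF distribution clopen_cylinder[OF d]
        clopen_cylinder[OF reversal_in_cover[OF d]]] by simp
  then show ?thesis
    using arc_mass_eq[OF d] arc_mass_eq[OF reversal_in_cover[OF d]] by simp
qed

lemma sum_arcs_reverse: "(\<Sum>e\<in>arcs G. f (r e)) = (\<Sum>e\<in>arcs G. f e :: int)"
proof (rule sum.reindex_bij_betw)
  show "bij_betw r (arcs G) (arcs G)"
    using arev_permutes_arcs by (rule permutes_imp_bij)
qed

text \<open>
  Both \<open>card (verts G) * \<mu> boundary\<close> and half of \<open>card (arcs G) * \<mu> boundary\<close> are the sum
  of all arc masses: group the arcs by their initial vertex, or pair each arc with its reverse.
\<close>

lemma total_mass:
  "(2 * int (card (verts G)) - int (card (arcs G))) * \<mu> boundary = 0"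
proof -
  have "int (card (verts G)) * \<mu> boundary = (\<Sum>w\<in>verts G. \<Sum>e\<in>out_arcs G w. arc_mass \<mu> e)"
    using arc_mass_sum by simp
  also have "\<dots> = (\<Sum>e\<in>arcs G. arc_mass \<mu> e)"
    unfolding out_arcs_def by (rule sum.group) auto
  finally have *: "int (card (verts G)) * \<mu> boundary = (\<Sum>e\<in>arcs G. arc_mass \<mu> e)" .
  have "int (card (arcs G)) * \<mu> boundary = (\<Sum>e\<in>arcs G. arc_mass \<mu> e + arc_mass \<mu> (r e))"
    using arc_mass_reverse by simp
  also have "\<dots> = 2 * (\<Sum>e\<in>arcs G. arc_mass \<mu> e)"
    using sum_arcs_reverse[of "arc_mass \<mu>"] by (simp add: sum.distrib)
  finally show ?thesis using * by (simp add: algebra_simps)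
qed

end

section \<open>The distribution of a cycle\<close>

text \<open>
  The antisymmetric extension of a chain on oriented arcs to all arcs. Expressed in this form, it is
  additive in \<open>c\<close> and does not mention the orientation.
\<close>

definition flow :: "('b \<Rightarrow>\<^sub>0 int) \<Rightarrow> 'b \<Rightarrow> int" where
  "flow c e = poly_mapping.lookup c e - poly_mapping.lookup c (r e)"

lemma flow_reverse: "flow c (r e) = - flow c e"
  by (simp add: flow_def)

lemma flow_add: "flow (c + c') e = flow c e + flow c' e"
  by (simp add: flow_def lookup_add)

text \<open>
  The boundary of \<open>c\<close> at \<open>w\<close> is what enters \<open>w\<close> minus what leaves it. Reversal turns the entering
  arcs into leaving ones, so the two parts combine to minus the outflow of \<open>flow c\<close>.
\<close>

lemma lookup_edge_boundary:
  assumes "Poly_Mapping.keys c \<subseteq> arcs G"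
  shows "poly_mapping.lookup (edge_boundary G c) w = - (\<Sum>e\<in>out_arcs G w. flow c e)"
proof -
  let ?c = "poly_mapping.lookup c"
  have "poly_mapping.lookup (edge_boundary G c) w
      = (\<Sum>e\<in>Poly_Mapping.keys c. ?c e * ((1 when head G e = w) - (1 when tail G e = w)))"
    by (simp add: edge_boundary_def frag_extend_def lookup_sum lookup_minus lookup_single
        when_def eq_commute[of w])
  also have "\<dots> = (\<Sum>e\<in>arcs G. ?c e * ((1 when head G e = w) - (1 when tail G e = w)))"
    using assms by (intro sum.mono_neutral_left) (auto simp: in_keys_iff)
  also have "\<dots> = (\<Sum>e\<in>arcs G. if head G e = w then ?c e else 0)
      - (\<Sum>e\<in>arcs G. if tail G e = w then ?c e else 0)"
    by (subst sum_subtractf[symmetric], rule sum.cong) (auto simp: when_def)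
  also have "\<dots> = (\<Sum>e\<in>in_arcs G w. ?c e) - (\<Sum>e\<in>out_arcs G w. ?c e)"
    by (simp add: sum.inter_filter in_arcs_def out_arcs_def)
  also have "(\<Sum>e\<in>in_arcs G w. ?c e) = (\<Sum>e\<in>out_arcs G w. ?c (r e))"
    unfolding in_arcs_eq by (subst sum.reindex) auto
  finally show ?thesis by (simp add: flow_def sum_subtractf)
qed

definition cycles :: "('b \<Rightarrow>\<^sub>0 int) set" where
  "cycles = {c. Poly_Mapping.keys c \<subseteq> arcs G \<and> edge_boundary G c = 0}"

lemma flow_conserved:
  assumes "c \<in> cycles"
  shows "(\<Sum>e\<in>out_arcs G w. flow c e) = 0"
  using assms lookup_edge_boundary[of c w] by (simp add: cycles_def)

definition last_flow :: "('b \<Rightarrow>\<^sub>0 int) \<Rightarrow> 'b list \<Rightarrow> int" where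
  "last_flow c p = (if p = [] then 0 else flow c (last p))"

text \<open>
  A walk ending with the arc \<open>f\<close> extends by all arcs that leave its final vertex except \<open>r f\<close>. By
  conservation, the flow through these arcs is minus the flow through \<open>r f\<close>, that is, the flow
  through \<open>f\<close>. For the empty walk no arc is excluded, which is why it has weight \<open>0\<close>.
\<close>

lemma harmonic_last_flow:
  assumes c: "c \<in> cycles"
  shows "harmonic (last_flow c)"
  unfolding harmonic_def
proof
  fix p assume p: "p \<in> reduced_walks"
  have *: "(\<Sum>e | p @ [e] \<in> reduced_walks. last_flow c (p @ [e]))
      = (\<Sum>e | p @ [e] \<in> reduced_walks. flow c e)"
    by (simp add: last_flow_def)
  show "last_flow c p = (\<Sum>e | p @ [e] \<in> reduced_walks. last_flow c (p @ [e]))"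
  proof (cases p rule: rev_cases)
    case Nil
    have "{e. p @ [e] \<in> reduced_walks} = out_arcs G v"
      unfolding Nil snoc_reduced_walk by auto
    then show ?thesis
      unfolding * using flow_conserved[OF c] Nil by (simp add: last_flow_def)
  next
    case (snoc q f)
    have f: "f \<in> arcs G" using p snoc by (simp add: snoc_reduced_walk del: awalk_verts.simps)
    have tip: "tip p = head G f" "last p = f" "p \<noteq> []"
      using snoc tip_snoc[of q f] by simp_all
    have "{e. p @ [e] \<in> reduced_walks} = out_arcs G (head G f) - {r f}"
      unfolding snoc_reduced_walk tip using p tip(3) by auto
    moreover have "r f \<in> out_arcs G (head G f)" using f by simp
    ultimately have "(\<Sum>e | p @ [e] \<in> reduced_walks. flow c e) = 0 - flow c (r f)"
      using flow_conserved[OF c, of "head G f"] by (simp add: sum_diff1 finite_out_arcs)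
    then show ?thesis
      unfolding * using snoc by (simp add: last_flow_def flow_reverse)
  qed
qed

definition cycle_distribution ::
    "('b \<Rightarrow>\<^sub>0 int) \<Rightarrow> (nat \<Rightarrow> 'b list \<times> 'b) set set \<Rightarrow> int" where
  "cycle_distribution c A =
     (if A \<in> clopens boundary_space then content (last_flow c) (ends A) else 0)"

lemma cycle_distribution_add:
  "cycle_distribution (c + c') A = cycle_distribution c A + cycle_distribution c' A"
proof -
  have "last_flow (c + c') p = last_flow c p + last_flow c' p" for p
    by (simp add: last_flow_def flow_add)
  then show ?thesis by (simp add: cycle_distribution_def content_def sum.distrib)
qed

lemma cycle_distribution:
  assumes c: "c \<in> cycles"
  shows "cycle_distribution c \<in> distributions boundary_space"
  unfolding distributions_def mem_Collect_eq
proof (intro conjI)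
  show "additive (clopens boundary_space) (cycle_distribution c)"
    unfolding additive_def
  proof (intro ballI impI)
    fix A B assume AB: "A \<in> clopens boundary_space" "B \<in> clopens boundary_space" "A \<inter> B = {}"
    obtain m n where "determined m (ends A)" "determined n (ends B)"
      using AB clopen_determined by metis
    moreover have "ends A \<inter> ends B = {}" using AB(3) by (auto simp: ends_def)
    ultimately show "cycle_distribution c (A \<union> B) = cycle_distribution c A + cycle_distribution c B"
      using AB content_Un[OF harmonic_last_flow[OF c] ends_subset ends_subset]
      by (simp add: cycle_distribution_def clopen_Un ends_Un)
  qed
qed (simp add: cycle_distribution_def)

lemma ends_image: "W \<subseteq> branches \<Longrightarrow> ends (endpoint ` W) = W"
  using inj_on_endpoint unfolding ends_def inj_on_def by blast

text \<open>
  For an edge pointing away from the base vertex, the cylinder consists of the branches through one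
  word, and the value is the weight of that word. For an edge pointing towards the base vertex, the
  cylinder is the complement of one of the former kind; the total mass is the weight \<open>0\<close> of the empty
  walk, so the value is minus that of the reversed edge.
\<close>

lemma cycle_distribution_cylinder:
  assumes c: "c \<in> cycles" and d: "(q, e) \<in> arcs cover"
  shows "cycle_distribution c (cylinder (q, e)) = flow c e"
proof -
  let ?\<mu> = "cycle_distribution c"
  note H = harmonic_last_flow[OF c]
  have forward: "?\<mu> (cylinder (q, e)) = flow c e" if "q @ [e] \<in> reduced_walks" for q e
  proof -
    have "(q, e) \<in> arcs cover" using that by (simp only: snoc_reduced_walk cover_arcs)
    then have "?\<mu> (cylinder (q, e)) =
        content (last_flow c) (ends (endpoint ` {w \<in> branches. stem w (length (q @ [e])) = q @ [e]}))"
      by (simp only: cycle_distribution_def clopen_cylinder cylinder_forward[OF that] if_True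
          flip: cylinder_forward[OF that])
    also have "\<dots> = last_flow c (q @ [e])"
      using content_cylinder[OF H that] ends_image by simp
    finally show ?thesis by (simp add: last_flow_def)
  qed
  show ?thesis
  proof (cases "backward q e")
    case False
    then show ?thesis using forward forward_iff[OF d] by blast
  next
    case True
    then obtain q' f where q': "q = q' @ [f]" "e = r f" by (rule backwardE)
    have "q' @ [f] \<in> reduced_walks" using d q' by (simp add: cover_arcs)
    then have red: "reduced r q'" "reduce r (q @ [e]) = q'"
      using reduce_snoc_cancel[of q' f] q' by (simp_all add: in_reduced_walks reduced_snoc)
    have "cylinder (q', f) = boundary - cylinder (q, e)"
      using cylinder_reversal[OF d] red q' by simp
    moreover have d': "(q', f) \<in> arcs cover"
      using reversal_in_cover[OF d] red q' by simp
    ultimately have "?\<mu> boundary = ?\<mu> (cylinder (q, e)) + ?\<mu> (cylinder (q', f))"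
      using distribution_Un[OF cycle_distribution[OF c] clopen_cylinder[OF d] clopen_cylinder[OF d']]
        cylinder_subset[of "(q, e)"] by (simp add: Un_absorb1)
    moreover have "?\<mu> (cylinder (q', f)) = flow c f"
      using forward \<open>q' @ [f] \<in> reduced_walks\<close> by blast
    moreover have "?\<mu> boundary = 0"
      using content_cylinder[OF H Nil_reduced_walk] clopen_boundary ends_image[of branches]
      by (simp add: cycle_distribution_def boundary_eq last_flow_def)
    ultimately show ?thesis by (simp add: q'(2) flow_reverse)
  qed
qed

lemma cycle_distribution_invariant:
  assumes c: "c \<in> cycles"
  shows "cycle_distribution c \<in> carrier (invariant_distributions G r v)"
proof (rule invariant_if_invariant_on_cylinders[OF cycle_distribution[OF c]])
  fix d g assume d: "d \<in> arcs cover" and g: "g \<in> carrier (fundamental_group G r v)"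
  obtain q e where qe: "d = (q, e)" by (cases d)
  have "cover_act r g d \<in> arcs cover"
    using act_arcs d g by (simp add: fundamental_group_carrier)
  then show "cycle_distribution c (cylinder (cover_act r g d)) = cycle_distribution c (cylinder d)"
    using cycle_distribution_cylinder[OF c] d by (simp add: qe cover_act_def)
qed

lemma cycle_distribution_inject:
  assumes "c \<in> cycles" "c' \<in> cycles" "cycle_distribution c = cycle_distribution c'" "e \<in> arcs G"
  shows "flow c e = flow c' e"
  using arc_lift[OF assms(4)] cycle_distribution_cylinder assms(1-3) by metis

section \<open>The isomorphism\<close>

context
  fixes E
  assumes E: "orientation G r E"
begin

lemma oriented_arcs: "E \<subseteq> arcs G" "finite E"
  using E finite_arcs by (auto simp: orientation_def intro: finite_subset)

lemma card_arcs: "card (arcs G) = 2 * card E"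
proof -
  have "card (arcs G) = card E + card (r ` E)"
    using E oriented_arcs(2) unfolding orientation_def by (metis card_Un_disjoint finite_imageI)
  then show ?thesis by (simp add: card_image inj_on_arev)
qed

lemma reverse_notin_orientation: "e \<in> E \<Longrightarrow> r e \<notin> E"
  using E unfolding orientation_def by blast

lemma carrier_first_homology:
  "c \<in> carrier (first_homology G E) \<longleftrightarrow> Poly_Mapping.keys c \<subseteq> E \<and> edge_boundary G c = 0"
  by (auto simp: first_homology_def kernel_def)

lemma first_homology_cycles: "carrier (first_homology G E) \<subseteq> cycles"
  using oriented_arcs(1) unfolding cycles_def subset_iff
  by (simp add: carrier_first_homology subset_iff)

lemma flow_eq_lookup:
  assumes "c \<in> carrier (first_homology G E)" "e \<in> E"
  shows "flow c e = poly_mapping.lookup c e"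
proof -
  have "r e \<notin> Poly_Mapping.keys c"
    using assms reverse_notin_orientation unfolding carrier_first_homology by blast
  then show ?thesis by (simp add: flow_def in_keys_iff)
qed

text \<open>
  On an oriented arc, the flow of the chain with coefficients \<open>f\<close> is \<open>f\<close>, because the reversed arc
  has coefficient \<open>0\<close>; antisymmetry gives the other arcs.
\<close>

lemma chain_of_flow:
  assumes anti: "\<And>e. e \<in> arcs G \<Longrightarrow> f (r e) = - f e"
    and cons: "\<And>w. w \<in> verts G \<Longrightarrow> (\<Sum>e\<in>out_arcs G w. f e) = 0"
  shows "\<exists>c\<in>carrier (first_homology G E). \<forall>e\<in>arcs G. flow c e = f e"
proof -
  define c where "c = (\<Sum>e\<in>E. frag_cmul (f e) (frag_of e))"
  have lookup: "poly_mapping.lookup c e = (f e when e \<in> E)" for e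
  proof -
    have "poly_mapping.lookup c e = (\<Sum>e'\<in>E. if e' = e then f e' else 0)"
      unfolding c_def lookup_sum by (intro sum.cong) (auto simp: when_def)
    then show ?thesis using oriented_arcs(2) by (simp add: when_def)
  qed
  have keys: "Poly_Mapping.keys c \<subseteq> E"
    by (auto simp: in_keys_iff lookup when_def split: if_splits)
  have flow: "flow c e = f e" if e: "e \<in> arcs G" for e
  proof (cases "e \<in> E")
    case True
    then show ?thesis using reverse_notin_orientation by (simp add: flow_def lookup)
  next
    case False
    then have "r e \<in> E"
      using E e unfolding orientation_def by (metis Un_iff arev_arev imageE)
    then show ?thesis using False anti[OF e] by (simp add: flow_def lookup)
  qed
  have "poly_mapping.lookup (edge_boundary G c) w = 0" for w
  proof -
    have "(\<Sum>e\<in>out_arcs G w. flow c e) = (\<Sum>e\<in>out_arcs G w. f e)"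
      using flow by (intro sum.cong) auto
    also have "\<dots> = 0"
    proof (cases "w \<in> verts G")
      case False
      then have "out_arcs G w = {}" by auto
      then show ?thesis by simp
    qed (rule cons)
    finally show ?thesis
      using lookup_edge_boundary[of c w] keys oriented_arcs(1) by simp
  qed
  then have "edge_boundary G c = 0" by (intro poly_mapping_eqI) simp
  then have "c \<in> carrier (first_homology G E)"
    using keys by (simp add: carrier_first_homology)
  with flow show ?thesis by blast
qed

text \<open>
  With vanishing total mass, the arc masses of \<open>\<mu>\<close> form an antisymmetric conserved flow. The
  distribution of the cycle with this flow has the same values on cylinders as \<open>\<mu>\<close>.
\<close>

lemma cycle_distribution_surj:
  assumes \<mu>: "\<mu> \<in> carrier (invariant_distributions G r v)"
    and \<chi>: "euler_characteristic G \<noteq> 0"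
  shows "\<exists>c\<in>carrier (first_homology G E). cycle_distribution c = \<mu>"
proof -
  have "2 * int (card (verts G)) - int (card (arcs G)) \<noteq> 0"
    using \<chi> card_arcs by (simp add: euler_characteristic_def)
  then have mass: "\<mu> boundary = 0" using total_mass[OF \<mu>] by simp
  have "\<exists>c\<in>carrier (first_homology G E). \<forall>e\<in>arcs G. flow c e = arc_mass \<mu> e"
  proof (rule chain_of_flow)
    show "arc_mass \<mu> (r e) = - arc_mass \<mu> e" if "e \<in> arcs G" for e
      using arc_mass_reverse[OF \<mu> that] mass by simp
    show "(\<Sum>e\<in>out_arcs G w. arc_mass \<mu> e) = 0" if "w \<in> verts G" for w
      using arc_mass_sum[OF \<mu> that] mass by simp
  qed
  then obtain c where c: "c \<in> carrier (first_homology G E)" "\<And>e. e \<in> arcs G \<Longrightarrow> flow c e = arc_mass \<mu> e"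
    by blast
  have cyc: "c \<in> cycles" using c(1) first_homology_cycles by blast
  have "cycle_distribution c = \<mu>"
  proof (rule distribution_eqI[OF cycle_distribution[OF cyc] distribution[OF \<mu>]])
    fix d assume d: "d \<in> arcs cover"
    obtain q e where qe: "d = (q, e)" by (cases d)
    then show "cycle_distribution c (cylinder d) = \<mu> (cylinder d)"
      using cycle_distribution_cylinder[OF cyc, of q e] arc_mass_eq[OF \<mu>, of q e] c(2)[of e] d
      by (simp add: cover_arcs)
  qed
  with c(1) show ?thesis by blast
qed

lemma cycle_distribution_iso:
  assumes "euler_characteristic G \<noteq> 0"
  shows "cycle_distribution \<in> iso (first_homology G E) (invariant_distributions G r v)"
  unfolding iso_def mem_Collect_eq
proof (intro conjI homI)
  fix c assume "c \<in> carrier (first_homology G E)"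
  then show "cycle_distribution c \<in> carrier (invariant_distributions G r v)"
    using cycle_distribution_invariant first_homology_cycles by blast
next
  fix c c'
  show "cycle_distribution (c \<otimes>\<^bsub>first_homology G E\<^esub> c') =
      cycle_distribution c \<otimes>\<^bsub>invariant_distributions G r v\<^esub> cycle_distribution c'"
    by (simp add: first_homology_def invariant_distributions_def fun_eq_iff cycle_distribution_add
        Let_def)
next
  show "bij_betw cycle_distribution (carrier (first_homology G E))
      (carrier (invariant_distributions G r v))"
    unfolding bij_betw_def
  proof
    show "inj_on cycle_distribution (carrier (first_homology G E))"
    proof (rule inj_onI)
      fix c c' assume c: "c \<in> carrier (first_homology G E)" "c' \<in> carrier (first_homology G E)"
        "cycle_distribution c = cycle_distribution c'"
      have "poly_mapping.lookup c e = poly_mapping.lookup c' e" for e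
      proof (cases "e \<in> E")
        case True
        have "flow c e = flow c' e"
          using cycle_distribution_inject c True first_homology_cycles oriented_arcs(1) by blast
        then show ?thesis using flow_eq_lookup c True by simp
      next
        case False
        then have "e \<notin> Poly_Mapping.keys c" "e \<notin> Poly_Mapping.keys c'"
          using c(1,2) unfolding carrier_first_homology by blast+
        then show ?thesis by (simp add: in_keys_iff)
      qed
      then show "c = c'" by (rule poly_mapping_eqI)
    qed
    show "cycle_distribution ` carrier (first_homology G E) =
        carrier (invariant_distributions G r v)"
      using cycle_distribution_invariant first_homology_cycles cycle_distribution_surj[OF _ assms]
      by blast
  qed
qed

end

end

theorem corollary1p2:
  fixes G :: "('a, 'b) pre_digraph" and r :: "'b \<Rightarrow> 'b" and E\<^sub>p :: "'b set" and v :: 'a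
  assumes "fin_digraph G"
    and "bidirected_digraph G r"
    and "Digraph_Component.connected G"
    and "orientation G r E\<^sub>p"
    and "v \<in> verts G"
    and "euler_characteristic G \<noteq> 0"
  shows "first_homology G E\<^sub>p \<cong> invariant_distributions G r v"
proof -
  interpret pointed_graph G r v
    using assms(1-3,5) by (simp add: pointed_graph_def pointed_graph_axioms_def)
  show ?thesis
    using cycle_distribution_iso[OF assms(4,6)] by (rule is_isoI)
qed

end
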